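(* There exists an algorithm (in the exploration model described in the context) that successfully explores every square path $P_n^2$ ($n\ge 1$) and that only ever assigns nonzero colors from the set $\{1,2,3,4\}$.
   Context: The square path $P_n^2$ is the graph with vertices $v_1,\dots,v_n$ in which $v_i$ and $v_j$ are adjacent iff $1\le |i-j|\le 2$. Exploration model. Graphs are finite, simple, undirected and connected; vertices are anonymous and edges carry no port labels. Each vertex carries a color in $\mathbb{N}=\{0,1,2,\dots\}$, where $0$ means "uncolored"; initially all vertices have color $0$. An algorithm is a function $\mathrm{move}$ mapping every environment $(c_0,E)$ — where $c_0\in\mathbb{N}$ is the color of the agent's current vertex and $E:\mathbb{N}\to\mathbb{N}$ (zero almost everywhere) gives, for each color $c$, the number $E(c)$ of neighbors of the current vertex having color $c$ — either to $\mathrm{Stop}$ or to a pair $(c_1,d)\in\mathbb{N}\times\mathbb{N}$ with $E(d)>0$, subject to $c_1=c_0$ whenever $c_0\neq 0$ (a vertex may only be colored while it is uncolored). A run on a graph $G$: an adversary chooses a start vertex $v_0$ and places the agent there; in each step, with the agent at $v$, $\mathrm{move}$ is evaluated at the environment of $v$; if the value is $\mathrm{Stop}$ the run ends, and if it is $(c_1,d)$ then $v$ receives color $c_1$ and the adversary chooses an arbitrary neighbor of $v$ of color $d$, to which the agent moves. The agent has no other memory. A vertex is visited if the agent is located at it in some step. An algorithm successfully explores $G$ if for every adversary (every choice of start vertex and of neighbors), after finitely many steps all vertices have been visited, the agent is at $v_0$, and the decision is $\mathrm{Stop}$. *)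

theory Defs
  imports "Graph_Theory.Graph_Theory"
begin

text \<open>Undirected simple graphs are symmetric loop-free pair digraphs (locale
  \<^locale>\<open>pair_graph\<close>): every edge is represented by its two arcs.\<close>

definition square_path :: "nat \<Rightarrow> nat pair_pre_digraph" where
  "square_path n =
     \<lparr> pverts = {1..n},
       parcs = {(i, j). i \<in> {1..n} \<and> j \<in> {1..n} \<and>
                  1 \<le> \<bar>int i - int j\<bar> \<and> \<bar>int i - int j\<bar> \<le> 2} \<rparr>"

lemma pair_graph_square_path: "pair_graph (square_path n)"
proof -
  have "parcs (square_path n) \<subseteq> {1..n} \<times> {1..n}"
    by (auto simp: square_path_def)
  then have "finite (parcs (square_path n))"
    by (rule finite_subset) simp
  then show ?thesis
    by unfold_locales (auto simp: square_path_def symmetric_def intro!: symI)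
qed

lemma connected_square_path:
  assumes "n \<ge> 1"
  shows "connected (with_proj (square_path n))"
proof -
  interpret pair_graph "square_path n" by (rule pair_graph_square_path)
  have from_1: "1 \<rightarrow>\<^sup>*\<^bsub>square_path n\<^esub> v" if "v \<ge> 1" "v \<le> n" for v
    using that
  proof (induction v rule: nat_induct_at_least)
    case base
    then show ?case
      by (intro reachable_refl) (auto simp: square_path_def)
  next
    case (Suc v)
    then have "(v, Suc v) \<in> parcs (square_path n)"
      by (auto simp: square_path_def)
    with Suc show ?case
      by (metis Suc_leD reachable_adj_trans with_proj_simps(3))
  qed
  have "strongly_connected (with_proj (square_path n))"
  proof (rule strongly_connectedI)
    show "verts (with_proj (square_path n)) \<noteq> {}"
      using assms by (auto simp: square_path_def)
    fix u v
    assume "u \<in> verts (with_proj (square_path n))" "v \<in> verts (with_proj (square_path n))"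
    then have "1 \<rightarrow>\<^sup>*\<^bsub>square_path n\<^esub> u" "1 \<rightarrow>\<^sup>*\<^bsub>square_path n\<^esub> v"
      using from_1 by (auto simp: square_path_def)
    then show "u \<rightarrow>\<^sup>*\<^bsub>square_path n\<^esub> v"
      using symmetric_reachable[OF sym_arcs] reachable_trans by blast
  qed
  then show ?thesis
    unfolding connected_def strongly_connected_def
    using reachable_mk_symmetricI by simp
qed

datatype decision = Stop | Go nat nat

text \<open>\<open>Go c d\<close>: give color \<open>c\<close> to the current vertex and move to a neighbor of color \<open>d\<close>.
  An algorithm maps an environment, i.e. the color \<open>c\<^sub>0\<close> of the current vertex together with
  the function \<open>E\<close> counting the neighbors of each color, to a decision. Environments are
  the pairs in which \<open>E\<close> is zero almost everywhere; the values of a function of this type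
  at other arguments are irrelevant.\<close>

type_synonym algorithm = "nat \<Rightarrow> (nat \<Rightarrow> nat) \<Rightarrow> decision"

definition environment :: "(nat \<Rightarrow> nat) \<Rightarrow> bool" where
  "environment E \<longleftrightarrow> finite {c. E c \<noteq> 0}"

definition is_algorithm :: "algorithm \<Rightarrow> bool" where
  "is_algorithm move \<longleftrightarrow>
     (\<forall>c\<^sub>0 E c\<^sub>1 d. environment E \<and> move c\<^sub>0 E = Go c\<^sub>1 d \<longrightarrow>
        E d > 0 \<and> (c\<^sub>0 \<noteq> 0 \<longrightarrow> c\<^sub>1 = c\<^sub>0))"

text \<open>The algorithm assigns a nonzero color exactly when it gives a color other than \<open>0\<close>
  to a vertex of color \<open>0\<close>.\<close>

definition assigns_only :: "algorithm \<Rightarrow> nat set \<Rightarrow> bool" where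
  "assigns_only move C \<longleftrightarrow>
     (\<forall>E c\<^sub>1 d. environment E \<and> move 0 E = Go c\<^sub>1 d \<and> c\<^sub>1 \<noteq> 0 \<longrightarrow> c\<^sub>1 \<in> C)"

definition neighbor_colors :: "'v pair_pre_digraph \<Rightarrow> ('v \<Rightarrow> nat) \<Rightarrow> 'v \<Rightarrow> nat \<Rightarrow> nat" where
  "neighbor_colors G col v c = card {w. (v, w) \<in> parcs G \<and> col w = c}"

text \<open>A configuration consists of the position of the agent and the current coloring.\<close>

type_synonym 'v config = "'v \<times> ('v \<Rightarrow> nat)"

fun decision_at :: "algorithm \<Rightarrow> 'v pair_pre_digraph \<Rightarrow> 'v config \<Rightarrow> decision" where
  "decision_at move G (v, col) = move (col v) (neighbor_colors G col v)"

fun step :: "algorithm \<Rightarrow> 'v pair_pre_digraph \<Rightarrow> 'v config \<Rightarrow> 'v config \<Rightarrow> bool" where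
  "step move G (v, col) s' \<longleftrightarrow>
     (case decision_at move G (v, col) of
        Stop \<Rightarrow> s' = (v, col)
      | Go c\<^sub>1 d \<Rightarrow> (\<exists>w. (v, w) \<in> parcs G \<and> col w = d \<and> s' = (w, col(v := c\<^sub>1))))"

text \<open>A run that has ended is continued by repeating its last configuration, so that
  terminating and non-terminating runs are both infinite sequences. Ranging over all runs
  amounts to ranging over all adversaries, since the \<open>w\<close> chosen in each step is
  unconstrained among the neighbors of the right color.\<close>

definition is_run :: "algorithm \<Rightarrow> 'v pair_pre_digraph \<Rightarrow> 'v \<Rightarrow> (nat \<Rightarrow> 'v config) \<Rightarrow> bool" where
  "is_run move G v\<^sub>0 s \<longleftrightarrow>
     v\<^sub>0 \<in> pverts G \<and> s 0 = (v\<^sub>0, \<lambda>_. 0) \<and> (\<forall>t. step move G (s t) (s (Suc t)))"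

definition successfully_explores :: "algorithm \<Rightarrow> 'v pair_pre_digraph \<Rightarrow> bool" where
  "successfully_explores move G \<longleftrightarrow>
     (\<forall>v\<^sub>0 s. is_run move G v\<^sub>0 s \<longrightarrow>
        (\<exists>t. decision_at move G (s t) = Stop \<and> fst (s t) = v\<^sub>0 \<and>
             pverts G \<subseteq> {fst (s i) | i. i \<le> t}))"

text \<open>Runs never get stuck, so the quantification over runs is not vacuous.\<close>

lemma ex_step:
  assumes "is_algorithm move" "finite (parcs G)"
  shows "\<exists>s'. step move G s s'"
proof -
  obtain v col where s: "s = (v, col)" by (cases s)
  let ?E = "neighbor_colors G col v"
  have fin: "finite {w. (v, w) \<in> parcs G}"
    by (rule finite_subset[OF _ finite_imageI[OF assms(2), of snd]]) force
  have "{c. ?E c \<noteq> 0} \<subseteq> col ` {w. (v, w) \<in> parcs G}"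
    by (auto simp: neighbor_colors_def card_eq_0_iff)
  then have env: "environment ?E"
    unfolding environment_def by (rule finite_subset) (use fin in simp)
  show ?thesis
  proof (cases "move (col v) ?E")
    case Stop
    then show ?thesis by (simp add: s)
  next
    case (Go c d)
    with assms(1) env have "?E d > 0" by (auto simp: is_algorithm_def)
    then obtain w where "(v, w) \<in> parcs G" "col w = d"
      by (auto simp: neighbor_colors_def card_gt_0_iff)
    with Go show ?thesis by (auto simp: s)
  qed
qed

lemma ex_run:
  assumes "is_algorithm move" "finite (parcs G)" "v\<^sub>0 \<in> pverts G"
  shows "\<exists>s. is_run move G v\<^sub>0 s"
proof -
  have "\<exists>s. s 0 = (v\<^sub>0, \<lambda>_. 0) \<and> (\<forall>t. step move G (s t) (s (Suc t)))"
    using dependent_nat_choice[of "\<lambda>t s. t = 0 \<longrightarrow> s = (v\<^sub>0, \<lambda>_. 0)" "\<lambda>_. step move G"]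
      ex_step[OF assms(1,2)] by auto
  with assms(3) show ?thesis by (auto simp: is_run_def)
qed

end

theory Submission
  imports Defs
begin

text \<open>
  Only the start vertex gets color \<open>4\<close>; all other vertices get colors \<open>1\<close>, \<open>2\<close>, \<open>3\<close>, ordered
  cyclically. The agent prefers uncolored neighbors and otherwise moves to a neighbor of the
  preceding color or, failing that, of the same color. On one side of the start the colors are
  distributed so that a vertex sees the preceding color only towards the start, so a sweep of that
  side always comes back. The adversary
  may send the agent past an uncolored vertex; the agent then sees a single colored neighbor,
  copies its color and steps back, whereupon the skipped vertex is the only uncolored choice.

  An environment containing \<open>4\<close> occurs only next to the start. There the rules are chosen such that
  the start has an uncolored neighbor whenever the agent returns to it with one side unexplored;
  hence the agent stops at the start as soon as it sees no uncolored neighbor.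
\<close>

section \<open>The algorithm\<close>

definition prv :: "nat \<Rightarrow> nat" where
  "prv c = (if c = 1 then 3 else c - 1)"

definition nxt :: "nat \<Rightarrow> nat" where
  "nxt c = (if c = 3 then 1 else c + 1)"

text \<open>The predicate \<open>S\<close> tells which colors occur among the neighbors. A vertex of color \<open>1\<close> that
  sees \<open>4\<close> but not \<open>3\<close> is an entrance to the start.\<close>

definition walk :: "nat \<Rightarrow> (nat \<Rightarrow> bool) \<Rightarrow> decision" where
  "walk c S =
     (if c = 4 then (if S 0 then Go c 0 else Stop)
      else if c = 1 \<and> S 4 \<and> \<not> S 3 then Go c 4
      else if S 0 then Go c 0
      else if S (prv c) then Go c (prv c)
      else if S c then Go c c
      else Stop)"

text \<open>The colors \<open>1\<close>, \<open>2\<close>, \<open>4\<close> together are seen only across the start from a vertex of color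
  \<open>2\<close>. Color \<open>3\<close> then forces the return through that vertex, from where the other side can
  still be entered; color \<open>2\<close> would allow a premature return to the start.\<close>

definition paint :: "(nat \<Rightarrow> bool) \<Rightarrow> nat" where
  "paint S =
     (if \<not> S 1 \<and> \<not> S 2 \<and> \<not> S 3 then (if S 4 then 1 else 4)
      else if S 1 \<and> \<not> S 3 \<and> \<not> (S 2 \<and> S 4) then 2
      else if S 2 \<and> (\<not> S 1 \<or> S 4) then 3
      else 1)"

text \<open>A count of neighbors is needed only for the second rule: a vertex reached in order may
  see two colored neighbors of the same color, so the set of seen colors would not reveal that the
  agent has passed an uncolored vertex. Color \<open>4\<close> is excluded because next to the start
  a single colored neighbor is normal.\<close>

definition explorer :: algorithm where
  "explorer c E =
     (let S = (\<lambda>i. E i > 0) in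
      if c \<noteq> 0 then walk c S
      else if E 1 + E 2 + E 3 = 1 \<and> E 4 = 0
        then (let i = (if S 1 then 1 else if S 2 then 2 else 3) in Go i i)
      else walk (paint S) S)"

lemma walk_Go: "walk c S = Go c' d \<Longrightarrow> c' = c \<and> S d"
  by (auto simp: walk_def split: if_splits)

lemma paint_range: "paint S \<in> {1, 2, 3, 4}"
  by (auto simp: paint_def)

lemma is_algorithm_explorer: "is_algorithm explorer"
  unfolding is_algorithm_def
proof (intro allI impI, elim conjE)
  fix c E c' d
  assume "explorer c E = Go c' d"
  then show "E d > 0 \<and> (c \<noteq> 0 \<longrightarrow> c' = c)"
    by (auto simp: explorer_def Let_def dest: walk_Go split: if_splits)
qed

lemma assigns_only_explorer: "assigns_only explorer {1, 2, 3, 4}"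
  unfolding assigns_only_def
proof (intro allI impI, elim conjE)
  fix E c d
  assume "explorer 0 E = Go c d"
  then show "c \<in> {1, 2, 3, 4}"
    using paint_range[of "\<lambda>i. E i > 0"]
    by (auto simp: explorer_def Let_def dest: walk_Go split: if_splits)
qed

section \<open>Winning configurations\<close>

text \<open>In the rule for \<open>Stop\<close> it suffices that every vertex is colored, because only visited
  vertices are. The start is exempt: in the graph with one vertex it stays uncolored.\<close>

inductive wins :: "algorithm \<Rightarrow> 'v pair_pre_digraph \<Rightarrow> 'v \<Rightarrow> 'v \<Rightarrow> ('v \<Rightarrow> nat) \<Rightarrow> bool"
  for move G v0 where
  wins_Stop: "wins move G v0 v0 col"
    if "move (col v0) (neighbor_colors G col v0) = Stop"
       "\<And>u. u \<in> pverts G \<Longrightarrow> u \<noteq> v0 \<Longrightarrow> col u \<noteq> 0"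
| wins_Go: "wins move G v0 v col"
    if "move (col v) (neighbor_colors G col v) = Go c d"
       "\<And>w. (v, w) \<in> parcs G \<Longrightarrow> col w = d \<Longrightarrow> wins move G v0 w (col(v := c))"

text \<open>Only the current vertex is ever recolored, so along a run every colored vertex has been
  visited; this invariant turns the coloring condition of \<open>wins_Stop\<close> into visits. The
  start is covered because the agent stands on it when it stops.\<close>

lemma wins_run:
  assumes "wins move G v0 v col" "\<forall>t. step move G (s t) (s (Suc t))"
    and "s t = (v, col)" "\<forall>u. col u \<noteq> 0 \<longrightarrow> (\<exists>i\<le>t. fst (s i) = u)"
  shows "\<exists>t. decision_at move G (s t) = Stop \<and> fst (s t) = v0 \<and>
             pverts G \<subseteq> {fst (s i) | i. i \<le> t}"
  using assms
proof (induction arbitrary: t rule: wins.induct)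
  case (wins_Stop col)
  then have "pverts G \<subseteq> {fst (s i) | i. i \<le> t}"
    by clarsimp (metis fst_conv order_refl)
  with wins_Stop show ?case by (intro exI[of _ t]) auto
next
  case (wins_Go col v c d)
  have "step move G (v, col) (s (Suc t))" using wins_Go.prems by metis
  then obtain w where w: "(v, w) \<in> parcs G" "col w = d" "s (Suc t) = (w, col(v := c))"
    using wins_Go.hyps by auto
  have "\<exists>i\<le>Suc t. fst (s i) = u" if "(col(v := c)) u \<noteq> 0" for u
  proof (cases "u = v")
    case True
    with wins_Go.prems show ?thesis by (intro exI[of _ t]) auto
  next
    case False
    with that wins_Go.prems show ?thesis by (metis fun_upd_other le_Suc_eq)
  qed
  with wins_Go.IH[OF w(1,2) wins_Go.prems(1) w(3)] show ?case by blast
qed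

lemma successfully_exploresI:
  assumes "\<And>v. v \<in> pverts G \<Longrightarrow> wins move G v v (\<lambda>_. 0)"
  shows "successfully_explores move G"
  unfolding successfully_explores_def is_run_def
proof (intro allI impI, elim conjE)
  fix v s
  assume "v \<in> pverts G" "s 0 = (v, \<lambda>_. 0)" "\<forall>t. step move G (s t) (s (Suc t))"
  then show "\<exists>t. decision_at move G (s t) = Stop \<and> fst (s t) = v \<and>
      pverts G \<subseteq> {fst (s i) | i. i \<le> t}"
    using wins_run[OF assms, of v s 0] by auto
qed

section \<open>Transfer between graphs and segments of the integers\<close>

text \<open>Decisions depend only on color counts, and \<open>f\<close> maps the neighbors of
  \<open>u\<close> bijectively to those of \<open>f u\<close>. So both agents see the same
  environments and every adversary move can be copied.\<close>

lemma wins_pullback: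
  assumes "wins move H v0 v col" "inj f" "v0 = f u0" "v = f u"
    and arcs: "\<And>u y. (f u, y) \<in> parcs H \<longleftrightarrow> (\<exists>w. y = f w \<and> (u, w) \<in> parcs G)"
    and verts: "f ` pverts G \<subseteq> pverts H"
  shows "wins move G u0 u (col \<circ> f)"
proof -
  have nc: "neighbor_colors H col (f u) = neighbor_colors G (col \<circ> f) u" for u col
  proof
    fix c
    have "{y. (f u, y) \<in> parcs H \<and> col y = c} = f ` {w. (u, w) \<in> parcs G \<and> (col \<circ> f) w = c}"
      by (auto simp: arcs)
    then show "neighbor_colors H col (f u) c = neighbor_colors G (col \<circ> f) u c"
      unfolding neighbor_colors_def
      by (simp only: card_image[OF inj_on_subset[OF \<open>inj f\<close> subset_UNIV]])
  qed
  show ?thesis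
    using assms(1,3,4)
  proof (induction arbitrary: u rule: wins.induct)
    case (wins_Stop col)
    then have [simp]: "u = u0" using \<open>inj f\<close> by (auto dest: injD)
    show ?case
      using wins_Stop verts \<open>inj f\<close>
      by (auto simp: nc comp_def inj_eq intro!: wins.wins_Stop)
  next
    case (wins_Go col v c d)
    show ?case
    proof (rule wins.wins_Go)
      show "move ((col \<circ> f) u) (neighbor_colors G (col \<circ> f) u) = Go c d"
        using wins_Go by (simp add: nc)
      fix w
      assume "(u, w) \<in> parcs G" "(col \<circ> f) w = d"
      then have "wins move G u0 w (col(v := c) \<circ> f)"
        using wins_Go.prems arcs by (intro wins_Go.IH[of "f w"]) auto
      moreover have "col(v := c) \<circ> f = (col \<circ> f)(u := c)"
        using \<open>inj f\<close> wins_Go.prems by (auto simp: fun_eq_iff inj_eq)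
      ultimately show "wins move G u0 w ((col \<circ> f)(u := c))" by simp
    qed
  qed
qed

text \<open>The square path on the integers \<open>l..r\<close>. Putting the start at \<open>0\<close> makes the reflection
  at the start a sign change.\<close>

definition sq_segment :: "int \<Rightarrow> int \<Rightarrow> int pair_pre_digraph" where
  "sq_segment l r =
     \<lparr> pverts = {l..r},
       parcs = {(i, j). i \<in> {l..r} \<and> j \<in> {l..r} \<and> 1 \<le> \<bar>i - j\<bar> \<and> \<bar>i - j\<bar> \<le> 2} \<rparr>"

abbreviation W :: "int \<Rightarrow> int \<Rightarrow> int \<Rightarrow> (int \<Rightarrow> nat) \<Rightarrow> bool" where
  "W l r \<equiv> wins explorer (sq_segment l r) 0"

lemma wins_reflect:
  assumes "W (- r) (- l) (- v) (\<lambda>k. col (- k))"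
  shows "W l r v col"
proof -
  have "W l r v ((\<lambda>k. col (- k)) \<circ> uminus)"
  proof (rule wins_pullback[OF assms])
    fix u y
    show "(- u, y) \<in> parcs (sq_segment (- r) (- l)) \<longleftrightarrow>
        (\<exists>w. y = - w \<and> (u, w) \<in> parcs (sq_segment l r))" (is "?L \<longleftrightarrow> ?R")
    proof
      assume ?L
      then show ?R by (intro exI[of _ "- y"]) (auto simp: sq_segment_def)
    qed (auto simp: sq_segment_def)
  qed (auto simp: sq_segment_def)
  then show ?thesis by (simp add: comp_def)
qed

lemma wins_square_path:
  assumes "W (1 - int s) (int n - int s) 0 (\<lambda>_. 0)"
  shows "wins explorer (square_path n) s s (\<lambda>_. 0)"
proof -
  have "wins explorer (square_path n) s s ((\<lambda>_. 0) \<circ> (\<lambda>v. int v - int s))"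
  proof (rule wins_pullback[OF assms])
    fix u y
    show "(int u - int s, y) \<in> parcs (sq_segment (1 - int s) (int n - int s)) \<longleftrightarrow>
        (\<exists>w. y = int w - int s \<and> (u, w) \<in> parcs (square_path n))" (is "?L \<longleftrightarrow> ?R")
    proof
      assume ?L
      then show ?R
        by (intro exI[of _ "nat (y + int s)"]) (auto simp: sq_segment_def square_path_def)
    qed (auto simp: sq_segment_def square_path_def)
  qed (auto simp: sq_segment_def square_path_def inj_def)
  then show ?thesis by (simp add: comp_def)
qed

section \<open>Single moves on a segment\<close>

definition nb :: "int \<Rightarrow> int \<Rightarrow> int \<Rightarrow> int set" where
  "nb l r v = {w \<in> {v - 2, v - 1, v + 1, v + 2}. l \<le> w \<and> w \<le> r}"

definition sees :: "int \<Rightarrow> int \<Rightarrow> (int \<Rightarrow> nat) \<Rightarrow> int \<Rightarrow> nat \<Rightarrow> bool" where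
  "sees l r col v x \<longleftrightarrow> (\<exists>w\<in>nb l r v. col w = x)"

lemma parcs_sq_segment: "l \<le> v \<Longrightarrow> v \<le> r \<Longrightarrow> (v, w) \<in> parcs (sq_segment l r) \<longleftrightarrow> w \<in> nb l r v"
  by (auto simp: sq_segment_def nb_def)

lemma finite_nb [simp]: "finite (nb l r v)"
  by (simp add: nb_def)

lemma neighbor_colors_sq_segment:
  assumes "l \<le> v" "v \<le> r"
  shows "neighbor_colors (sq_segment l r) col v c = card {w \<in> nb l r v. col w = c}"
  using assms by (simp add: neighbor_colors_def parcs_sq_segment)

lemma neighbor_colors_sees:
  assumes "l \<le> v" "v \<le> r"
  shows "neighbor_colors (sq_segment l r) col v c > 0 \<longleftrightarrow> sees l r col v c"
  using assms by (auto simp: neighbor_colors_sq_segment sees_def card_gt_0_iff)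

lemma neighbor_colors_upd [simp]:
  "neighbor_colors (sq_segment l r) (col(v := c)) v = neighbor_colors (sq_segment l r) col v"
  by (auto simp: fun_eq_iff neighbor_colors_def sq_segment_def intro!: arg_cong[where f = card])

lemma wins_walk:
  assumes "l \<le> v" "v \<le> r" "col v \<noteq> 0" "walk (col v) (sees l r col v) = Go (col v) d"
    and "\<And>w. w \<in> nb l r v \<Longrightarrow> col w = d \<Longrightarrow> W l r w col"
  shows "W l r v col"
proof (rule wins_Go)
  show "explorer (col v) (neighbor_colors (sq_segment l r) col v) = Go (col v) d"
    using assms by (simp add: explorer_def neighbor_colors_sees)
qed (use assms in \<open>simp add: parcs_sq_segment\<close>)

text \<open>No vertex is its own neighbor, so painting \<open>v\<close> leaves its environment
  unchanged: the decision at the uncolored vertex is the one it would make after being painted.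
  Coloring and moving can thus be treated separately. The assumption \<open>many\<close> excludes
  the rule for a single colored neighbor.\<close>

lemma wins_paint:
  assumes v: "l \<le> v" "v \<le> r" "col v = 0" and c: "c = paint (sees l r col v)"
    and many: "sees l r col v 4 \<or> (\<forall>w\<in>nb l r v. col w = 0) \<or>
      (\<exists>w\<in>nb l r v. \<exists>w'\<in>nb l r v. w \<noteq> w' \<and> col w \<in> {1, 2, 3} \<and> col w' \<in> {1, 2, 3})"
    and W: "W l r v (col(v := c))"
  shows "W l r v col"
proof -
  let ?E = "neighbor_colors (sq_segment l r) col v"
  have no_jump: "\<not> (?E 1 + ?E 2 + ?E 3 = 1 \<and> ?E 4 = 0)"
  proof
    assume one: "?E 1 + ?E 2 + ?E 3 = 1 \<and> ?E 4 = 0"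
    have "?E 1 + ?E 2 + ?E 3 = card {w \<in> nb l r v. col w \<in> {1, 2, 3}}"
    proof -
      have "{w \<in> nb l r v. col w \<in> {1, 2, 3}} = {w \<in> nb l r v. col w = 1} \<union>
          {w \<in> nb l r v. col w = 2} \<union> {w \<in> nb l r v. col w = 3}" by auto
      then show ?thesis
        using v by (simp add: neighbor_colors_sq_segment) (subst card_Un_disjoint; auto)+
    qed
    with one obtain x where x: "{w \<in> nb l r v. col w \<in> {1, 2, 3}} = {x}"
      by (metis card_1_singletonE)
    then have uniq: "w = x" if "w \<in> nb l r v" "col w \<in> {1, 2, 3}" for w using that by blast
    have "x \<in> {w \<in> nb l r v. col w \<in> {1, 2, 3}}" using x by (rule equalityD2[THEN subsetD]) simp
    then have x: "x \<in> nb l r v" "col x \<noteq> 0" by auto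
    have 4: "\<not> sees l r col v 4"
      using one neighbor_colors_sees[OF v(1,2), of col 4] by linarith
    from many show False
    proof (elim disjE bexE conjE)
      fix w w'
      assume "w \<in> nb l r v" "w' \<in> nb l r v" "w \<noteq> w'" "col w \<in> {1, 2, 3}" "col w' \<in> {1, 2, 3}"
      with uniq[of w] uniq[of w'] show False by simp
    qed (use 4 x in simp_all)
  qed
  have "explorer 0 ?E = walk (paint (\<lambda>i. ?E i > 0)) (\<lambda>i. ?E i > 0)"
    unfolding explorer_def Let_def by (subst if_not_P, simp, subst if_not_P[OF no_jump], rule refl)
  then have eq: "explorer (col v) ?E = explorer c ?E"
    using v c paint_range[of "sees l r col v"]
    by (auto simp: explorer_def neighbor_colors_sees Let_def)
  from W show ?thesis
  proof (cases rule: wins.cases)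
    case wins_Stop
    then show ?thesis using eq v
      by (auto intro!: wins.wins_Stop simp: fun_upd_other)
  next
    case (wins_Go c' d)
    show ?thesis
    proof (rule wins.wins_Go)
      show "explorer (col v) ?E = Go c' d" using wins_Go eq by simp
      fix w
      assume "(v, w) \<in> parcs (sq_segment l r)" "col w = d"
      moreover from this have "w \<noteq> v" by (auto simp: sq_segment_def)
      ultimately show "W l r w (col(v := c'))" using wins_Go(2)[of w] by simp
    qed
  qed
qed

lemma wins_jump:
  assumes v: "l \<le> v" "v \<le> r" "col v = 0" and w: "w \<in> nb l r v" "col w \<in> {1, 2, 3}"
    and others: "\<And>u. u \<in> nb l r v \<Longrightarrow> u \<noteq> w \<Longrightarrow> col u = 0"
    and W: "W l r w (col(v := col w))"
  shows "W l r v col"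
proof (rule wins_Go)
  have "{u \<in> nb l r v. col u = c} = (if c = col w then {w} else {})" if "c \<noteq> 0" for c
    using others w(1) that by (cases "c = col w") (fastforce dest: others)+
  then have "neighbor_colors (sq_segment l r) col v c = (if c = col w then 1 else 0)" if "c \<noteq> 0" for c
    using v that by (simp add: neighbor_colors_sq_segment)
  then show "explorer (col v) (neighbor_colors (sq_segment l r) col v) = Go (col w) (col w)"
    using v w by (auto simp: explorer_def Let_def)
  fix u
  assume "(v, u) \<in> parcs (sq_segment l r)" "col u = col w"
  with v w others[of u] have "u = w" by (cases "u = w") (auto simp: parcs_sq_segment)
  with W show "W l r u (col(v := col w))" by simp
qed

section \<open>Sweeping one side\<close>

text \<open>The color given to a vertex whose colored neighbors have the colors \<open>a\<close> and \<open>b\<close>.\<close>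

definition nx :: "nat \<Rightarrow> nat \<Rightarrow> nat" where
  "nx a b = paint (\<lambda>i. i = a \<or> i = b)"

lemma paint_cong:
  assumes "S 1 = T 1" "S 2 = T 2" "S 3 = T 3" "S 4 = T 4"
  shows "paint S = paint T"
  using assms by (simp add: paint_def)

lemma sees_iff:
  "sees l r col v x \<longleftrightarrow>
     (l \<le> v - 2 \<and> v - 2 \<le> r \<and> col (v - 2) = x) \<or> (l \<le> v - 1 \<and> v - 1 \<le> r \<and> col (v - 1) = x) \<or>
     (l \<le> v + 1 \<and> v + 1 \<le> r \<and> col (v + 1) = x) \<or> (l \<le> v + 2 \<and> v + 2 \<le> r \<and> col (v + 2) = x)"
  unfolding sees_def nb_def by blast

lemma nb_iff:
  "w \<in> nb l r v \<longleftrightarrow> l \<le> w \<and> w \<le> r \<and> (w = v - 2 \<or> w = v - 1 \<or> w = v + 1 \<or> w = v + 2)"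
  unfolding nb_def by blast

text \<open>The entrance rule precedes the search for uncolored neighbors. It needs color
  \<open>1\<close> with \<open>4\<close> in sight and \<open>3\<close>, the predecessor of
  \<open>1\<close>, out of sight; the fifth assumption rules this out.\<close>

lemma walk_zero:
  assumes "l \<le> v" "v \<le> r" "col v \<in> {1, 2, 3}" "sees l r col v 0"
    and "sees l r col v (prv (col v)) \<or> \<not> sees l r col v 4"
    and "\<And>w. w \<in> nb l r v \<Longrightarrow> col w = 0 \<Longrightarrow> W l r w col"
  shows "W l r v col"
  using assms by - (rule wins_walk[where d = 0]; auto simp: walk_def prv_def)

lemma walk_prv:
  assumes "l \<le> v" "v \<le> r" "col v \<in> {1, 2, 3}" "\<not> sees l r col v 0"
    and "sees l r col v (prv (col v))"
    and "\<And>w. w \<in> nb l r v \<Longrightarrow> col w = prv (col v) \<Longrightarrow> W l r w col"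
  shows "W l r v col"
  using assms by - (rule wins_walk[where d = "prv (col v)"]; auto simp: walk_def prv_def)

lemma walk_same:
  assumes "l \<le> v" "v \<le> r" "col v \<in> {1, 2, 3}" "\<not> sees l r col v 0"
    and "\<not> sees l r col v 4" "\<not> sees l r col v (prv (col v))" "sees l r col v (col v)"
    and "\<And>w. w \<in> nb l r v \<Longrightarrow> col w = col v \<Longrightarrow> W l r w col"
  shows "W l r v col"
  using assms by - (rule wins_walk[where d = "col v"]; auto simp: walk_def prv_def)

lemma walk_home:
  assumes "l \<le> v" "v \<le> r" "col v = 1" "sees l r col v 4" "\<not> sees l r col v 3"
    and "\<And>w. w \<in> nb l r v \<Longrightarrow> col w = 4 \<Longrightarrow> W l r w col"
  shows "W l r v col"
  using assms by - (rule wins_walk[where d = 4]; auto simp: walk_def prv_def)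

text \<open>Apart from \<open>4\<close>, a single color is followed by its successor, and two
  cyclically consecutive colors by the later one. Hence a new vertex always sees its predecessor
  color on one of the two vertices that determined its color.\<close>

lemma nx_props:
  assumes "a \<in> {1, 2, 3, 4}" "b \<in> {1, 2, 3, 4}" "a \<noteq> 4 \<or> b \<noteq> 4"
  shows "nx a b \<in> {1, 2, 3}" "prv (nx a b) = a \<or> prv (nx a b) = b"
    and "b = 4 \<or> b = nx a b \<or> b = prv (nx a b)"
  using assms unfolding insert_iff empty_iff by (elim disjE; simp add: nx_def paint_def prv_def nxt_def)+

text \<open>Each color tends to be used twice in a row. The last two identities say that the color
  two places beyond \<open>c\<close>, or the one after a repeated \<open>c\<close>, is
  \<open>nxt c\<close> no matter what \<open>b\<close> was; this makes the sweep independent of the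
  adversary.\<close>

lemma nx_next:
  assumes "c \<in> {1, 2, 3}" "b = 4 \<or> b = c \<or> b = prv c"
  shows "nx b c = c \<and> b = prv c \<or> nx b c = nxt c \<and> b \<noteq> prv c"
    and "nx c (nx b c) = nxt c" "nx (nx b c) c = nxt c"
  using assms unfolding insert_iff empty_iff by (elim disjE; simp add: nx_def paint_def prv_def nxt_def)+

lemma color_props:
  assumes "c \<in> {1, 2, 3}"
  shows "c \<noteq> 0" "prv c \<noteq> 0" "nxt c \<noteq> 0" "prv c \<noteq> c" "nxt c \<noteq> c" "nxt c \<noteq> prv c"
    "c \<noteq> 4" "prv c \<noteq> 4" "nxt c \<noteq> 4" "prv (nxt c) = c"
    "prv c \<in> {1, 2, 3}" "nxt c \<in> {1, 2, 3}"
  using assms unfolding insert_iff empty_iff by (elim disjE; simp add: prv_def nxt_def)+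

text \<open>Further colored neighbors are allowed if they repeat one of the two colors, as happens
  at a vertex that was skipped.\<close>

lemma paint_pair:
  assumes v: "l \<le> v" "v \<le> r" "col v = 0"
    and w: "w \<in> nb l r v" "w' \<in> nb l r v" "w \<noteq> w'"
    and cols: "col w \<in> {1, 2, 3, 4}" "col w' \<in> {1, 2, 3, 4}"
    and others: "\<And>u. u \<in> nb l r v \<Longrightarrow> col u \<in> {0, col w, col w'}"
    and W: "W l r v (col(v := nx (col w) (col w')))"
  shows "W l r v col"
proof (rule wins_paint[of l v r col, OF v])
  have "sees l r col v x \<longleftrightarrow> x = col w \<or> x = col w'" if "x \<noteq> 0" for x
    unfolding sees_def using w others that by (metis empty_iff insert_iff)
  then show "nx (col w) (col w') = paint (sees l r col v)"
    unfolding nx_def by (intro paint_cong) auto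
  show "sees l r col v 4 \<or> (\<forall>w\<in>nb l r v. col w = 0) \<or>
      (\<exists>w\<in>nb l r v. \<exists>w'\<in>nb l r v. w \<noteq> w' \<and> col w \<in> {1, 2, 3} \<and> col w' \<in> {1, 2, 3})"
    using w cols by (auto simp: sees_def)
qed (use W in simp)

text \<open>The agent enters the uncolored region \<open>{p<..}\<close> at \<open>p + 1\<close>; it can only leave it to \<open>p - 1\<close> or \<open>p\<close>,
  and not through the start. The colors of \<open>p + 1\<close> and \<open>p + 2\<close> do not depend on the adversary
  and are all that the vertices up to \<open>p\<close> can see of the region.\<close>

lemma sweep_right:
  assumes "l \<le> p - 1" "p + 1 \<le> r" "col (p - 1) \<in> {1, 2, 3, 4}" "col p \<in> {1, 2, 3, 4}"
    and "col (p - 1) \<noteq> 4 \<or> col p \<noteq> 4" "\<forall>k>p. col k = 0"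
    and "\<And>q col'. q \<in> {p - 1, p} \<Longrightarrow> col q \<noteq> 4 \<Longrightarrow> \<forall>k\<le>p. col' k = col k \<Longrightarrow>
       \<forall>k. p < k \<and> k \<le> r \<longrightarrow> col' k \<noteq> 0 \<Longrightarrow> col' (p + 1) = nx (col (p - 1)) (col p) \<Longrightarrow>
       (p + 2 \<le> r \<Longrightarrow> col' (p + 2) = nx (col p) (nx (col (p - 1)) (col p))) \<Longrightarrow> W l r q col'"
  shows "W l r (p + 1) col"
  using assms
proof (induction "nat (r - p)" arbitrary: p col rule: less_induct)
  case less
  define a b c where "a = col (p - 1)" and "b = col p" and "c = nx a b"
  define e where "e = nx b c"
  have ab: "a \<in> {1, 2, 3, 4}" "b \<in> {1, 2, 3, 4}" "a \<noteq> 4 \<or> b \<noteq> 4"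
    using less.prems by (auto simp: a_def b_def)
  note c = nx_props[OF ab, folded c_def]
  note e = nx_next[OF c(1,3), folded e_def]
  note cs = color_props[OF c(1)]
  have c4: "c \<in> {1, 2, 3, 4}" and e4: "e \<in> {1, 2, 3, 4}"
    using c(1) e(1) cs(12) by auto
  have ab0: "a \<noteq> 0" "b \<noteq> 0" using ab by auto
  have e0: "e \<noteq> 0" "e \<noteq> 4" "e \<noteq> prv c"
    using e(1) cs by metis+
  let ?col = "col(p + 1 := c)"
  have nb1: "w = p - 1 \<or> w = p \<or> w = p + 2 \<or> w = p + 3" if "w \<in> nb l r (p + 1)" for w
    using that by (auto simp: nb_iff)
  \<comment> \<open>With the region full, \<open>p + 1\<close> sees the color \<open>prv c\<close>
    at \<open>p - 1\<close> or \<open>p\<close> but nowhere to its right, so the agent leaves; as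
    \<open>prv c\<close> is not \<open>4\<close>, it does not leave through the start.\<close>
  have retreat: "W l r (p + 1) col'"
    if col': "\<forall>k\<le>p. col' k = col k" "\<forall>k. p < k \<and> k \<le> r \<longrightarrow> col' k \<noteq> 0"
      "col' (p + 1) = c" "p + 2 \<le> r \<Longrightarrow> col' (p + 2) = e" "p + 3 \<le> r \<Longrightarrow> col' (p + 3) \<noteq> prv c" for col'
  proof -
    have pts: "col' (p - 1) = a" "col' p = b"
      using col'(1) by (simp_all add: a_def b_def)
    show ?thesis
    proof (rule walk_prv)
      show "\<not> sees l r col' (p + 1) 0"
        using col'(2) pts ab0 by (simp add: sees_iff)
      show "sees l r col' (p + 1) (prv (col' (p + 1)))"
        using c(2) less.prems(1,2) by (auto simp add: sees_iff pts col'(3))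
      fix w
      assume w: "w \<in> nb l r (p + 1)" "col' w = prv (col' (p + 1))"
      from w(1) have "w = p - 1 \<or> w = p \<or> w = p + 2 \<or> w = p + 3" "w \<le> r"
        by (auto simp: nb_iff)
      then have "w = p - 1 \<or> w = p"
        using w(2) col'(3-5) e0 by metis
      then have "w \<in> {p - 1, p}" "col w \<noteq> 4"
        using w(2) col'(1,3) cs(8) by auto
      then show "W l r w col'"
        using col' by (intro less.prems(7)) (simp_all add: a_def b_def c_def e_def)
    qed (use less.prems(1,2) col'(3) c(1) in auto)
  qed
  show ?case
  proof (rule paint_pair[where w = "p - 1" and w' = p])
    have "W l r (p + 1) ?col"
    proof (cases "p + 2 \<le> r")
      case False
      then show ?thesis by (intro retreat) (use cs(1) in auto)
    next
      case True
      \<comment> \<open>The adversary proceeds in order: the induction hypothesis for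
        \<open>p + 1\<close> ends at \<open>p\<close>, an exit, or at \<open>p + 1\<close>, from
        where the agent retreats because \<open>p + 3\<close> has color
        \<open>nxt c\<close>.\<close>
      have direct: "W l r (p + 2) ?col"
      proof -
        have "W l r (p + 1 + 1) ?col"
        proof (rule less.hyps)
          fix q col'
          assume q: "q \<in> {p + 1 - 1, p + 1}" "?col q \<noteq> 4"
            and col': "\<forall>k\<le>p + 1. col' k = ?col k" "\<forall>k. p + 1 < k \<and> k \<le> r \<longrightarrow> col' k \<noteq> 0"
              "col' (p + 1 + 1) = nx (?col (p + 1 - 1)) (?col (p + 1))"
              "p + 1 + 2 \<le> r \<Longrightarrow> col' (p + 1 + 2) = nx (?col (p + 1)) (nx (?col (p + 1 - 1)) (?col (p + 1)))"
          have same: "\<forall>k\<le>p. col' k = col k" "col' (p + 1) = c" "col' (p + 2) = e"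
            and p3: "p + 3 \<le> r \<Longrightarrow> col' (p + 3) = nxt c"
            using col' e by (auto simp: b_def e_def algebra_simps)
          have full: "\<forall>k. p < k \<and> k \<le> r \<longrightarrow> col' k \<noteq> 0"
          proof (intro allI impI)
            fix k assume "p < k \<and> k \<le> r"
            then show "col' k \<noteq> 0"
              using col'(2) same(2) cs by (cases "k = p + 1") auto
          qed
          show "W l r q col'"
          proof (cases "q = p")
            case True
            with q same full show ?thesis
              by (intro less.prems(7)) (auto simp: a_def b_def c_def e_def)
          next
            case False
            with q have "q = p + 1" by auto
            with same full p3 cs show ?thesis by (auto intro!: retreat)
          qed
        qed (use True less.prems ab c(1) cs in \<open>auto simp: b_def\<close>)
        then show ?thesis by (simp add: algebra_simps)
      qed
      \<comment> \<open>The adversary skips \<open>p + 2\<close>. The agent copies \<open>c\<close>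
        to \<open>p + 3\<close>, returns to \<open>p + 1\<close>, and then \<open>p + 2\<close> is
        the only uncolored neighbor.\<close>
      have jump: "W l r (p + 3) ?col" if p3: "p + 3 \<le> r"
      proof -
        let ?col2 = "?col(p + 3 := c)"
        let ?col3 = "?col2(p + 2 := e)"
        have nb2: "w = p \<or> w = p + 1 \<or> w = p + 3 \<or> w = p + 4 \<and> p + 4 \<le> r" if "w \<in> nb l r (p + 2)" for w
          using that by (auto simp: nb_iff)
        have nb: "p \<in> nb l r (p + 2)" "p + 1 \<in> nb l r (p + 2)" "p + 1 \<in> nb l r (p + 3)"
          using less.prems(1) p3 by (auto simp: nb_iff)
        have c3: "?col3 p = b" "?col3 (p + 1) = c" "?col3 (p + 2) = e" "?col3 (p + 3) = c"
          by (simp_all add: b_def)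
        have finish: "W l r (p + 2) col' \<and> W l r (p + 3) col'"
          if col': "\<forall>k\<le>p + 3. col' k = ?col3 k" "\<forall>k. p + 3 < k \<and> k \<le> r \<longrightarrow> col' k \<noteq> 0"
            "p + 4 \<le> r \<Longrightarrow> col' (p + 4) = nxt c" "p + 5 \<le> r \<Longrightarrow> col' (p + 5) = nxt c" for col'
        proof -
          have pts: "\<forall>k\<le>p. col' k = col k" "col' p = b" "col' (p + 1) = c" "col' (p + 2) = e" "col' (p + 3) = c"
            using col'(1) by (simp_all add: b_def)
          have full: "\<forall>k. p < k \<and> k \<le> r \<longrightarrow> col' k \<noteq> 0"
          proof (intro allI impI)
            fix k assume k: "p < k \<and> k \<le> r"
            then consider "k = p + 1" | "k = p + 2" | "k = p + 3" | "p + 3 < k" by linarith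
            then show "col' k \<noteq> 0"
              by cases (use k col'(2) pts cs e0 in auto)
          qed
          have full': "\<not> sees l r col' v 0" if "p + 2 \<le> v" "v \<le> p + 3" for v
          proof -
            have "col' w \<noteq> 0" if "w \<in> nb l r v" for w
            proof -
              have "w \<le> r" "p \<le> w" using that \<open>p + 2 \<le> v\<close> by (auto simp: nb_iff)
              then show ?thesis using full pts(2) ab0 by (cases "w = p") auto
            qed
            then show ?thesis by (auto simp: sees_def)
          qed
          have nb3: "w = p + 1 \<or> w = p + 2 \<or> w = p + 4 \<and> p + 4 \<le> r \<or> w = p + 5 \<and> p + 5 \<le> r"
            if "w \<in> nb l r (p + 3)" for w
            using that by (auto simp: nb_iff)
          have Wp: "W l r p col'" if "b \<noteq> 4"
            using pts full that by (intro less.prems(7)) (auto simp: a_def b_def c_def e_def)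
          have W1: "W l r (p + 1) col'"
            using pts full cs by (intro retreat) auto
          \<comment> \<open>If \<open>e = c\<close>, the predecessor color of \<open>p + 2\<close>
            is found at \<open>p\<close> and not at \<open>p + 3\<close>. Otherwise
            \<open>e = nxt c\<close>, and the agent may be sent to \<open>p + 1\<close> or
            \<open>p + 3\<close>.\<close>
          have W2: "W l r (p + 2) col'" if "e = c \<or> W l r (p + 3) col'"
          proof (rule walk_prv)
            show "\<not> sees l r col' (p + 2) 0" by (rule full') auto
            show "sees l r col' (p + 2) (prv (col' (p + 2)))"
              unfolding sees_def using e(1) nb pts cs by metis
            show "W l r w col'" if "w \<in> nb l r (p + 2)" "col' w = prv (col' (p + 2))" for w
              using nb2[OF that(1)] that(2) \<open>e = c \<or> W l r (p + 3) col'\<close> e(1) pts(2-5) cs col'(3) Wp W1 by metis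
          qed (use less.prems(1) p3 pts e4 e0 in auto)
          \<comment> \<open>The copied color has no predecessor in sight here; this is what the rule
            of moving to the same color is for. It leads to \<open>p + 2\<close> only if
            \<open>e = c\<close>.\<close>
          have W3: "W l r (p + 3) col'" if "e \<noteq> c \<or> W l r (p + 2) col'"
          proof (rule walk_same)
            show "\<not> sees l r col' (p + 3) 0" by (rule full') auto
            show "\<not> sees l r col' (p + 3) 4"
              unfolding sees_def using nb3 pts(3-5) cs e0 col'(3,4) by metis
            show "\<not> sees l r col' (p + 3) (prv (col' (p + 3)))"
              unfolding sees_def using nb3 pts(3-5) cs e0 col'(3,4) by metis
            show "sees l r col' (p + 3) (col' (p + 3))"
              unfolding sees_def using nb pts(3-5) by metis
            show "W l r w col'" if "w \<in> nb l r (p + 3)" "col' w = col' (p + 3)" for w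
              using nb3[OF that(1)] that(2) \<open>e \<noteq> c \<or> W l r (p + 2) col'\<close> pts(3-5) cs col'(3,4) W1 by metis
          qed (use less.prems(1) p3 pts c(1) in auto)
          \<comment> \<open>The two conditions exclude a cycle: for \<open>e = c\<close> the vertex
            \<open>p + 2\<close> is settled first, otherwise \<open>p + 3\<close>.\<close>
          show ?thesis using W2 W3 by metis
        qed
        \<comment> \<open>The sweep resumes with \<open>p + 2\<close> and \<open>p + 3\<close> as
          the colored pair. Their colors \<open>e\<close> and \<open>c\<close> give
          \<open>nxt c\<close> to both \<open>p + 4\<close> and \<open>p + 5\<close>, as
          \<open>finish\<close> requires.\<close>
        have W4: "W l r (p + 4) ?col3" if "p + 4 \<le> r"
        proof -
          have "W l r (p + 3 + 1) ?col3"
          proof (rule less.hyps)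
            fix q col'
            assume q: "q \<in> {p + 3 - 1, p + 3}"
              and col': "\<forall>k\<le>p + 3. col' k = ?col3 k" "\<forall>k. p + 3 < k \<and> k \<le> r \<longrightarrow> col' k \<noteq> 0"
                "col' (p + 3 + 1) = nx (?col3 (p + 3 - 1)) (?col3 (p + 3))"
                "p + 3 + 2 \<le> r \<Longrightarrow> col' (p + 3 + 2) = nx (?col3 (p + 3)) (nx (?col3 (p + 3 - 1)) (?col3 (p + 3)))"
            have "nx c (nxt c) = nxt c"
              using nx_next(1)[of "nxt c" c] nx_next[OF c(1), of c] e by (metis c(1) nx_next(2))
            then have "W l r (p + 2) col' \<and> W l r (p + 3) col'"
              using col' e by (intro finish) (simp_all add: algebra_simps)
            with q show "W l r q col'" by (auto simp: algebra_simps)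
          qed (use that less.prems(1,6) e4 e0 c4 cs in auto)
          then show ?thesis by (simp add: algebra_simps)
        qed
        have W2: "W l r (p + 2) ?col3"
        proof (cases "p + 4 \<le> r")
          case True
          show ?thesis
          proof (rule walk_zero)
            show "sees l r ?col3 (p + 2) (prv (?col3 (p + 2))) \<or> \<not> sees l r ?col3 (p + 2) 4"
              unfolding sees_def using e(1) nb c3 cs by metis
            show "sees l r ?col3 (p + 2) 0"
              using True less.prems(1,6) by (simp add: sees_iff)
            fix w
            assume "w \<in> nb l r (p + 2)" "?col3 w = 0"
            then have "w = p + 4"
              using nb2 c3 ab0 cs e0 by metis
            with W4 True show "W l r w ?col3" by simp
          qed (use e4 e0 p3 less.prems(1) in auto)
        next
          case False
          then show ?thesis using finish[of ?col3] by simp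
        qed
        \<comment> \<open>Copying the color of \<open>p + 1\<close> to \<open>p + 3\<close> adds no
          color to those seen from \<open>p + 2\<close>, which therefore gets the same color
          \<open>e\<close> as without the skip.\<close>
        have "W l r (p + 2) ?col2"
        proof (rule paint_pair[where w = p and w' = "p + 1"])
          show "W l r (p + 2) (?col2(p + 2 := nx (?col2 p) (?col2 (p + 1))))"
            using W2 by (simp add: b_def e_def)
          show "?col2 u \<in> {0, ?col2 p, ?col2 (p + 1)}" if "u \<in> nb l r (p + 2)" for u
            using nb2[OF that] less.prems(6) by auto
        qed (use less.prems(1,4,6) p3 c4 nb in simp_all)
        have sees_prv: "sees l r ?col2 (p + 1) (prv c)"
          using c(2) less.prems(1,2) by (auto simp: sees_iff a_def b_def)
        have "W l r (p + 1) ?col2"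
        proof (rule walk_zero)
          show "sees l r ?col2 (p + 1) (prv (?col2 (p + 1))) \<or> \<not> sees l r ?col2 (p + 1) 4"
            using sees_prv by simp
          show "sees l r ?col2 (p + 1) 0"
            using p3 less.prems(1,6) by (simp add: sees_iff)
          fix w
          assume "w \<in> nb l r (p + 1)" "?col2 w = 0"
          then have "w = p + 2"
            using nb1[of w] ab0 cs(1) by (auto simp: a_def b_def)
          then show "W l r w ?col2" using \<open>W l r (p + 2) ?col2\<close> by simp
        qed (use less.prems(1,2) c(1) in auto)
        then have "W l r (p + 1) (?col(p + 3 := ?col (p + 1)))" by simp
        moreover have "?col u = 0" if "u \<in> nb l r (p + 3)" "u \<noteq> p + 1" for u
        proof -
          have "p < u" using that by (auto simp: nb_iff)
          then show ?thesis using that less.prems(6) by simp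
        qed
        ultimately show ?thesis
          using less.prems(1,6) p3 c(1) nb(3) by - (rule wins_jump[where w = "p + 1"]; simp)
      qed
      show ?thesis
      proof (rule walk_zero)
        show "sees l r ?col (p + 1) (prv (?col (p + 1))) \<or> \<not> sees l r ?col (p + 1) 4"
          using c(2) less.prems(1,2) by (auto simp: sees_iff a_def b_def)
        show "sees l r ?col (p + 1) 0"
          using True less.prems(1,6) by (simp add: sees_iff)
        fix w
        assume w: "w \<in> nb l r (p + 1)" "?col w = 0"
        then have "w = p + 2 \<or> w = p + 3 \<and> p + 3 \<le> r"
          using nb1[of w] ab0 by (auto simp: a_def b_def nb_iff)
        then show "W l r w ?col" using direct jump by auto
      qed (use less.prems(1,2) c(1) in auto)
    qed
    then show "W l r (p + 1) (col(p + 1 := nx (col (p - 1)) (col p)))"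
      by (simp add: a_def b_def c_def)
  qed (use less.prems in \<open>auto simp: nb_iff\<close>)
qed

declare One_nat_def [simp del]

lemma sweep_left:
  assumes "p + 1 \<le> r" "l \<le> p - 1" "col (p + 1) \<in> {1, 2, 3, 4}" "col p \<in> {1, 2, 3, 4}"
    and "col (p + 1) \<noteq> 4 \<or> col p \<noteq> 4" "\<forall>k<p. col k = 0"
    and final: "\<And>q col'. q \<in> {p, p + 1} \<Longrightarrow> col q \<noteq> 4 \<Longrightarrow> \<forall>k\<ge>p. col' k = col k \<Longrightarrow>
       \<forall>k. l \<le> k \<and> k < p \<longrightarrow> col' k \<noteq> 0 \<Longrightarrow> col' (p - 1) = nx (col (p + 1)) (col p) \<Longrightarrow>
       (l \<le> p - 2 \<Longrightarrow> col' (p - 2) = nx (col p) (nx (col (p + 1)) (col p))) \<Longrightarrow> W l r q col'"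
  shows "W l r (p - 1) col"
proof (rule wins_reflect)
  have "W (- r) (- l) (- p + 1) (\<lambda>k. col (- k))"
  proof (rule sweep_right)
    fix q col'
    assume q: "q \<in> {- p - 1, - p}" "col (- q) \<noteq> 4"
      and col': "\<forall>k\<le>- p. col' k = col (- k)" "\<forall>k. - p < k \<and> k \<le> - l \<longrightarrow> col' k \<noteq> 0"
        "col' (- p + 1) = nx (col (- (- p - 1))) (col (- (- p)))"
        "- p + 2 \<le> - l \<Longrightarrow> col' (- p + 2) = nx (col (- (- p))) (nx (col (- (- p - 1))) (col (- (- p))))"
    have "W l r (- q) (\<lambda>k. col' (- k))"
      using q col' by (intro final) (auto simp: algebra_simps)
    then show "W (- r) (- l) q col'"
      by (intro wins_reflect[of "- l" "- r" q]) simp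
  qed (use assms in \<open>auto simp: algebra_simps\<close>)
  then show "W (- r) (- l) (- (p - 1)) (\<lambda>k. col (- k))" by simp
qed

section \<open>The neighborhood of the start\<close>

lemma wins_full:
  assumes "l \<le> 0" "0 \<le> r" "col 0 = 4" "\<forall>k. l \<le> k \<and> k \<le> r \<longrightarrow> col k \<noteq> 0"
  shows "W l r 0 col"
proof (rule wins_Stop)
  have "\<not> sees l r col 0 0" using assms(4) by (auto simp: sees_def nb_iff)
  then show "explorer (col 0) (neighbor_colors (sq_segment l r) col 0) = Stop"
    using assms neighbor_colors_sees[of l 0 r col] by (simp add: explorer_def walk_def)
qed (use assms in \<open>simp add: sq_segment_def\<close>)

lemma wins_start:
  assumes "l \<le> 0" "0 \<le> r" "col 0 = 4"
    and "\<And>w. w \<in> nb l r 0 \<Longrightarrow> col w = 0 \<Longrightarrow> W l r w col"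
    and "\<forall>w\<in>nb l r 0. col w \<noteq> 0 \<Longrightarrow> \<forall>k. l \<le> k \<and> k \<le> r \<longrightarrow> col k \<noteq> 0"
  shows "W l r 0 col"
proof (cases "sees l r col 0 0")
  case True
  then show ?thesis
    using assms by - (rule wins_walk[where d = 0]; auto simp: walk_def prv_def)
next
  case False
  then show ?thesis using assms by (intro wins_full) (auto simp: sees_def)
qed

lemma wins_home:
  assumes "v \<in> nb l r 0" "l \<le> 0" "0 \<le> r" "col v = 1" "col 0 = 4"
    and "\<And>w. w \<in> nb l r v \<Longrightarrow> w \<noteq> 0 \<Longrightarrow> col w \<noteq> 3 \<and> col w \<noteq> 4"
    and "W l r 0 col"
  shows "W l r v col"
proof (rule walk_home)
  have "0 \<in> nb l r v" using assms(1-3) by (auto simp: nb_iff)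
  then show "sees l r col v 4" using assms(5) by (auto simp: sees_def)
  have "col w \<noteq> 3" if "w \<in> nb l r v" for w
    using assms(5) assms(6)[OF that] by (cases "w = 0") auto
  then show "\<not> sees l r col v 3" by (auto simp: sees_def)
  show "W l r w col" if "w \<in> nb l r v" "col w = 4" for w
    using assms(6)[of w] assms(7) that by (cases "w = 0") auto
qed (use assms(1,4) in \<open>auto simp: nb_iff\<close>)

text \<open>A vertex that sees only \<open>4\<close> and uncolored neighbors gets color
  \<open>1\<close> and is an entrance at once, so the agent returns without going further.\<close>

lemma wins_touch:
  assumes "v \<in> nb l r 0" "l \<le> 0" "0 \<le> r" "col v = 0" "col 0 = 4"
    and zero: "\<And>w. w \<in> nb l r v \<Longrightarrow> w \<noteq> 0 \<Longrightarrow> col w = 0"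
    and "W l r 0 (col(v := 1))"
  shows "W l r v col"
proof (rule wins_paint)
  have "0 \<in> nb l r v" "v \<noteq> 0" using assms(1-3) by (auto simp: nb_iff)
  then have S: "sees l r col v x \<longleftrightarrow> x = 4" if "x \<noteq> 0" for x
    using zero assms(5) that unfolding sees_def by metis
  then show "sees l r col v 4 \<or> (\<forall>w\<in>nb l r v. col w = 0) \<or>
      (\<exists>w\<in>nb l r v. \<exists>w'\<in>nb l r v. w \<noteq> w' \<and> col w \<in> {1, 2, 3} \<and> col w' \<in> {1, 2, 3})" by simp
  show "1 = paint (sees l r col v)" using S by (simp add: paint_def)
  show "W l r v (col(v := 1))"
  proof (rule wins_home[OF assms(1-3)])
    fix w assume w: "w \<in> nb l r v" "w \<noteq> 0"
    then have "w \<noteq> v" by (auto simp: nb_iff)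
    with zero[OF w] show "(col(v := 1)) w \<noteq> 3 \<and> (col(v := 1)) w \<noteq> 4" by simp
  qed (use assms \<open>v \<noteq> 0\<close> in simp_all)
qed (use assms(1,4) in \<open>auto simp: nb_iff\<close>)

text \<open>The left side is untouched, except that \<open>-2\<close> may have been visited directly from the start.\<close>

definition pending :: "int \<Rightarrow> (int \<Rightarrow> nat) \<Rightarrow> bool" where
  "pending l col \<longleftrightarrow> (\<forall>k<0. col k = 0) \<or> l \<le> -2 \<and> col (-2) = 1 \<and> (\<forall>k<0. k \<noteq> -2 \<longrightarrow> col k = 0)"

lemma nx_numeral [simp]:
  "nx 1 4 = 2" "nx 2 4 = 3" "nx 4 1 = 2" "nx 2 1 = 2" "nx 1 2 = 2" "nx 3 1 = 1" "nx 1 1 = 2"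
  by (simp_all add: nx_def paint_def)

section \<open>Excursions to the left side\<close>

text \<open>Whether or not \<open>-2\<close> was touched, \<open>-1\<close> sees just
  \<open>1\<close> and \<open>4\<close> and gets color \<open>2\<close>. This leaves the entrances
  at \<open>1\<close> and at a touched \<open>-2\<close> open, so every way back leads to the
  start.\<close>

lemma leave_left_1:
  assumes lr: "l \<le> -1" "1 \<le> r" and col: "col 0 = 4" "col 1 = 1" "pending l col"
    and right: "2 \<le> r \<Longrightarrow> col 2 \<notin> {3, 4}" "3 \<le> r \<Longrightarrow> col 3 \<notin> {3, 4}"
    and final: "\<And>col'. \<forall>k\<ge>0. col' k = col k \<Longrightarrow> \<forall>k. l \<le> k \<and> k < 0 \<longrightarrow> col' k \<noteq> 0 \<Longrightarrow>
      col' (-1) = 2 \<Longrightarrow> W l r 0 col'"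
  shows "W l r (-1) col"
proof -
  have W1: "W l r 1 col'" if "\<forall>k\<ge>0. col' k = col k" "\<forall>k. l \<le> k \<and> k < 0 \<longrightarrow> col' k \<noteq> 0" "col' (-1) = 2" for col'
  proof (rule wins_home)
    show "col' w \<noteq> 3 \<and> col' w \<noteq> 4" if "w \<in> nb l r 1" "w \<noteq> 0" for w
    proof -
      have "w = -1 \<or> w = 2 \<and> 2 \<le> r \<or> w = 3 \<and> 3 \<le> r" using that by (auto simp: nb_iff)
      then show ?thesis using \<open>\<forall>k\<ge>0. col' k = col k\<close> \<open>col' (-1) = 2\<close> right by auto
    qed
  qed (use that lr col final in \<open>auto simp: nb_iff\<close>)
  show ?thesis
  proof (cases "\<forall>k<0. col k = 0")
    case True
    \<comment> \<open>Here \<open>1\<close> and \<open>0\<close> are the colored pair of the sweep;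
      the color of \<open>0\<close> bars that exit, so the sweep ends at \<open>1\<close>.\<close>
    have "W l r (0 - 1) col"
      by (rule sweep_left) (use lr col W1 True in auto)
    then show ?thesis by simp
  next
    case False
    then have far: "l \<le> -2" "col (-2) = 1" "\<forall>k<0. k \<noteq> -2 \<longrightarrow> col k = 0"
      using col(3) by (auto simp: pending_def)
    let ?col = "col(-1 := 2)"
    have finish: "W l r (-1) col' \<and> W l r (-2) col'"
      if col': "\<forall>k\<ge>-2. col' k = ?col k" "\<forall>k. l \<le> k \<and> k < -2 \<longrightarrow> col' k \<noteq> 0"
        "l \<le> -3 \<Longrightarrow> col' (-3) = 2" "l \<le> -4 \<Longrightarrow> col' (-4) = 2" for col'
    proof -
      have pts: "\<forall>k\<ge>0. col' k = col k" "col' (-1) = 2" "col' (-2) = 1"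
        using col'(1) far(2) by simp_all
      have full: "\<forall>k. l \<le> k \<and> k < 0 \<longrightarrow> col' k \<noteq> 0"
      proof (intro allI impI)
        fix k assume k: "l \<le> k \<and> k < 0"
        then consider "k = -1" | "k = -2" | "k < -2" by linarith
        then show "col' k \<noteq> 0" by cases (use k col'(2) pts in auto)
      qed
      have W2: "W l r (-2) col'"
      proof (rule wins_home)
        show "col' w \<noteq> 3 \<and> col' w \<noteq> 4" if "w \<in> nb l r (-2)" "w \<noteq> 0" for w
        proof -
          have "w = -1 \<or> w = -3 \<and> l \<le> -3 \<or> w = -4 \<and> l \<le> -4" using that by (auto simp: nb_iff)
          then show ?thesis using pts col'(3,4) by auto
        qed
      qed (use pts full lr far col final in \<open>auto simp: nb_iff\<close>)
      have "W l r (-1) col'"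
      proof (rule walk_prv)
        have nb1: "w = -3 \<and> l \<le> -3 \<or> w = -2 \<or> w = 0 \<or> w = 1" if "w \<in> nb l r (-1)" for w
          using that by (auto simp: nb_iff)
        show "\<not> sees l r col' (-1) 0"
          unfolding sees_def using nb1 pts col'(3) col by fastforce
        show "sees l r col' (-1) (prv (col' (-1)))"
          using far lr pts by (simp add: sees_iff prv_def)
        show "W l r w col'" if "w \<in> nb l r (-1)" "col' w = prv (col' (-1))" for w
          using nb1[OF that(1)] that(2) pts col col'(3) W2 W1[OF pts(1) full pts(2)]
          by (auto simp: prv_def)
      qed (use lr pts in auto)
      with W2 show ?thesis by blast
    qed
    have W3: "W l r (-3) ?col" if "l \<le> -3"
    proof -
      have "W l r (-2 - 1) ?col"
      proof (rule sweep_left)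
        fix q col'
        assume "q \<in> {-2, -2 + 1 :: int}" "\<forall>k\<ge>-2. col' k = ?col k" "\<forall>k. l \<le> k \<and> k < -2 \<longrightarrow> col' k \<noteq> 0"
          "col' (-2 - 1) = nx (?col (-2 + 1)) (?col (-2))"
          "l \<le> -2 - 2 \<Longrightarrow> col' (-2 - 2) = nx (?col (-2)) (nx (?col (-2 + 1)) (?col (-2)))"
        then show "W l r q col'" using finish[of col'] far(2) by auto
      qed (use that lr far in auto)
      then show ?thesis by simp
    qed
    have W1': "W l r (-1) ?col"
    proof (cases "l \<le> -3")
      case True
      show ?thesis
      proof (rule walk_zero)
        show "sees l r ?col (-1) (prv (?col (-1))) \<or> \<not> sees l r ?col (-1) 4"
          using far lr by (simp add: sees_iff prv_def)
        show "sees l r ?col (-1) 0"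
          using far lr True by (simp add: sees_iff)
        fix w assume "w \<in> nb l r (-1)" "?col w = 0"
        then have "w = -3" using far lr col by (auto simp: nb_iff)
        with W3 True show "W l r w ?col" by simp
      qed (use lr in auto)
    next
      case False
      then show ?thesis using finish[of ?col] by auto
    qed
    show ?thesis
    proof (rule wins_paint)
      show "2 = paint (sees l r col (-1))"
        using far lr col by (simp add: paint_def sees_iff)
      show "sees l r col (-1) 4 \<or> (\<forall>w\<in>nb l r (-1). col w = 0) \<or>
        (\<exists>w\<in>nb l r (-1). \<exists>w'\<in>nb l r (-1). w \<noteq> w' \<and> col w \<in> {1, 2, 3} \<and> col w' \<in> {1, 2, 3})"
        using lr col by (simp add: sees_iff)
    qed (use lr far W1' in auto)
  qed
qed

text \<open>Now \<open>-1\<close> gets color \<open>3\<close>, by the special case of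
  \<open>paint\<close> if \<open>-2\<close> was touched. This closes the entrance at
  \<open>-2\<close>: from there the agent goes back to \<open>-1\<close>, which sees color
  \<open>2\<close> only at \<open>1\<close>. So the agent crosses to \<open>1\<close> without
  entering the start.\<close>

lemma leave_left_2:
  assumes lr: "l \<le> -1" "1 \<le> r" and col: "col 0 = 4" "col 1 = 2" "pending l col"
    and final: "\<And>col'. \<forall>k\<ge>0. col' k = col k \<Longrightarrow> \<forall>k. l \<le> k \<and> k < 0 \<longrightarrow> col' k \<noteq> 0 \<Longrightarrow>
      col' (-1) = 3 \<Longrightarrow> W l r 1 col'"
  shows "W l r (-1) col"
proof (cases "\<forall>k<0. col k = 0")
  case True
  have "W l r (0 - 1) col"
    by (rule sweep_left) (use lr col final True in auto)
  then show ?thesis by simp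
next
  case False
  then have far: "l \<le> -2" "col (-2) = 1" "\<forall>k<0. k \<noteq> -2 \<longrightarrow> col k = 0"
    using col(3) by (auto simp: pending_def)
  let ?col = "col(-1 := 3)"
  have finish: "W l r (-1) col' \<and> W l r (-2) col'"
    if col': "\<forall>k\<ge>-2. col' k = ?col k" "\<forall>k. l \<le> k \<and> k < -2 \<longrightarrow> col' k \<noteq> 0"
      "l \<le> -3 \<Longrightarrow> col' (-3) = 1" "l \<le> -4 \<Longrightarrow> col' (-4) = 2" for col'
  proof -
    have pts: "\<forall>k\<ge>0. col' k = col k" "col' (-1) = 3" "col' (-2) = 1"
      using col'(1) far(2) by simp_all
    have full: "\<forall>k. l \<le> k \<and> k < 0 \<longrightarrow> col' k \<noteq> 0"
    proof (intro allI impI)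
      fix k assume k: "l \<le> k \<and> k < 0"
      then consider "k = -1" | "k = -2" | "k < -2" by linarith
      then show "col' k \<noteq> 0" by cases (use k col'(2) pts in auto)
    qed
    have W1: "W l r (-1) col'"
    proof (rule walk_prv)
      have nb1: "w = -3 \<and> l \<le> -3 \<or> w = -2 \<or> w = 0 \<or> w = 1" if "w \<in> nb l r (-1)" for w
        using that by (auto simp: nb_iff)
      show "\<not> sees l r col' (-1) 0"
        unfolding sees_def using nb1 pts col'(3) col by fastforce
      show "sees l r col' (-1) (prv (col' (-1)))"
        using lr pts col by (simp add: sees_iff prv_def)
      show "W l r w col'" if "w \<in> nb l r (-1)" "col' w = prv (col' (-1))" for w
        using nb1[OF that(1)] that(2) pts col col'(3) final[OF pts(1) full pts(2)]
        by (auto simp: prv_def)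
    qed (use lr pts in auto)
    have "W l r (-2) col'"
    proof (rule walk_prv)
      have nb2: "w = -4 \<and> l \<le> -4 \<or> w = -3 \<and> l \<le> -3 \<or> w = -1 \<or> w = 0" if "w \<in> nb l r (-2)" for w
        using that by (auto simp: nb_iff)
      show "\<not> sees l r col' (-2) 0"
        unfolding sees_def using nb2 pts col'(3,4) col by fastforce
      show "sees l r col' (-2) (prv (col' (-2)))"
        using far lr pts by (simp add: sees_iff prv_def)
      show "W l r w col'" if "w \<in> nb l r (-2)" "col' w = prv (col' (-2))" for w
        using nb2[OF that(1)] that(2) pts col col'(3,4) W1
        by (auto simp: prv_def)
    qed (use far lr pts in auto)
    with W1 show ?thesis by blast
  qed
  have W3: "W l r (-3) ?col" if "l \<le> -3"
  proof -
    have "W l r (-2 - 1) ?col"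
    proof (rule sweep_left)
      fix q col'
      assume "q \<in> {-2, -2 + 1 :: int}" "\<forall>k\<ge>-2. col' k = ?col k" "\<forall>k. l \<le> k \<and> k < -2 \<longrightarrow> col' k \<noteq> 0"
        "col' (-2 - 1) = nx (?col (-2 + 1)) (?col (-2))"
        "l \<le> -2 - 2 \<Longrightarrow> col' (-2 - 2) = nx (?col (-2)) (nx (?col (-2 + 1)) (?col (-2)))"
      then show "W l r q col'" using finish[of col'] far(2) by auto
    qed (use that lr far in auto)
    then show ?thesis by simp
  qed
  have W1': "W l r (-1) ?col"
  proof (cases "l \<le> -3")
    case True
    show ?thesis
    proof (rule walk_zero)
      show "sees l r ?col (-1) (prv (?col (-1))) \<or> \<not> sees l r ?col (-1) 4"
        using lr col by (simp add: sees_iff prv_def)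
      show "sees l r ?col (-1) 0"
        using far lr True by (simp add: sees_iff)
      fix w assume "w \<in> nb l r (-1)" "?col w = 0"
      then have "w = -3" using far lr col by (auto simp: nb_iff)
      with W3 True show "W l r w ?col" by simp
    qed (use lr in auto)
  next
    case False
    then show ?thesis using finish[of ?col] by auto
  qed
  show ?thesis
  proof (rule wins_paint)
    show "3 = paint (sees l r col (-1))"
      using far lr col by (simp add: paint_def sees_iff)
    show "sees l r col (-1) 4 \<or> (\<forall>w\<in>nb l r (-1). col w = 0) \<or>
      (\<exists>w\<in>nb l r (-1). \<exists>w'\<in>nb l r (-1). w \<noteq> w' \<and> col w \<in> {1, 2, 3} \<and> col w' \<in> {1, 2, 3})"
      using lr col by (simp add: sees_iff)
  qed (use lr far W1' in auto)
qed

section \<open>Returns to the start\<close>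

text \<open>The only uncolored neighbor the start can have is \<open>-2\<close>. The sweep from
  there has \<open>0\<close> and \<open>-1\<close> as its colored pair, so it ends at
  \<open>-1\<close>, which is still an entrance, with everything colored.\<close>

lemma last_near:
  assumes lr: "l \<le> -1" "0 \<le> r" and col: "col 0 = 4" "col (-1) = 1" "\<forall>k < -1. col k = 0"
    and right: "\<forall>k. 0 < k \<and> k \<le> r \<longrightarrow> col k \<noteq> 0" "1 \<le> r \<Longrightarrow> col 1 \<notin> {3, 4}"
  shows "W l r 0 col"
proof (rule wins_start)
  fix w
  assume w0: "w \<in> nb l r 0" "col w = 0"
  then have "w \<le> r" by (simp add: nb_iff)
  with w0 right(1) have "\<not> 0 < w" by blast
  with w0 have w: "w = -2" "l \<le> -2" using col by (auto simp: nb_iff)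
  have "W l r (-1 - 1) col"
  proof (rule sweep_left)
    fix q col'
    assume "q \<in> {-1, -1 + 1}" "col q \<noteq> 4" and col': "\<forall>k\<ge>-1. col' k = col k"
      "\<forall>k. l \<le> k \<and> k < -1 \<longrightarrow> col' k \<noteq> 0" "col' (-1 - 1) = nx (col (-1 + 1)) (col (-1))"
      "l \<le> -1 - 2 \<Longrightarrow> col' (-1 - 2) = nx (col (-1)) (nx (col (-1 + 1)) (col (-1)))"
    then have q: "q = -1" using col by auto
    have full: "\<forall>k. l \<le> k \<and> k \<le> r \<longrightarrow> col' k \<noteq> 0"
    proof (intro allI impI)
      fix k assume k: "l \<le> k \<and> k \<le> r"
      then consider "k = 0" | "k = -1" | "k < -1" | "0 < k" by linarith
      then show "col' k \<noteq> 0" by cases (use k col' col right in auto)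
    qed
    have "W l r (-1) col'"
    proof (rule wins_home)
      show "col' w \<noteq> 3 \<and> col' w \<noteq> 4" if "w \<in> nb l r (-1)" "w \<noteq> 0" for w
      proof -
        have "w = -3 \<and> l \<le> -3 \<or> w = -2 \<and> l \<le> -2 \<or> w = 1 \<and> 1 \<le> r" using that by (auto simp: nb_iff)
        then show ?thesis using col' col right by auto
      qed
      show "W l r 0 col'" using lr col' col full by (intro wins_full) auto
    qed (use lr col col' in \<open>auto simp: nb_iff\<close>)
    with q show "W l r q col'" by simp
  qed (use lr w col in auto)
  with w show "W l r w col" by simp
next
  assume nz: "\<forall>w\<in>nb l r 0. col w \<noteq> 0"
  have "\<not> l \<le> -2"
  proof
    assume "l \<le> -2"
    with lr have "-2 \<in> nb l r 0" by (auto simp: nb_iff)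
    with nz col show False by auto
  qed
  show "\<forall>k. l \<le> k \<and> k \<le> r \<longrightarrow> col k \<noteq> 0"
  proof (intro allI impI)
    fix k assume k: "l \<le> k \<and> k \<le> r"
    then consider "k = 0" | "k = -1" | "0 < k" using \<open>\<not> l \<le> -2\<close> by linarith
    then show "col k \<noteq> 0" by cases (use k col right in auto)
  qed
qed (use lr col in auto)

lemma last_near_mirrored:
  assumes lr: "1 \<le> r" "l \<le> 0" and col: "col 0 = 4" "col 1 = 1" "\<forall>k>1. col k = 0"
    and left: "\<forall>k. l \<le> k \<and> k < 0 \<longrightarrow> col k \<noteq> 0" "l \<le> -1 \<Longrightarrow> col (-1) \<notin> {3, 4}"
  shows "W l r 0 col"
proof -
  have "W (- r) (- l) 0 (\<lambda>k. col (- k))"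
    by (rule last_near) (use assms in auto)
  then show ?thesis using wins_reflect[of r l 0 col] by simp
qed

lemma pending_touch: "\<forall>k<0. col k = 0 \<Longrightarrow> l \<le> -2 \<Longrightarrow> pending l (col(-2 := 1))"
  by (simp add: pending_def)

lemma pending_cong: "pending l col \<Longrightarrow> \<forall>k<0. col' k = col k \<Longrightarrow> pending l col'"
  by (simp add: pending_def)

text \<open>A step to an untouched \<open>-2\<close> leads straight back and keeps the left side
  pending, so it is absorbed here. Only steps to \<open>-1\<close> and to the right remain to be
  treated by the caller.\<close>

lemma start_pending:
  assumes lr: "l \<le> 0" "0 \<le> r" and col: "col 0 = 4" "pending l col"
    and right: "\<And>k. 0 < k \<Longrightarrow> k \<le> r \<Longrightarrow> col k = 0 \<Longrightarrow> \<exists>w\<in>{1, 2}. w \<le> r \<and> col w = 0"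
    and visit_left: "\<And>col'. l \<le> -1 \<Longrightarrow> pending l col' \<Longrightarrow> \<forall>k\<ge>0. col' k = col k \<Longrightarrow> W l r (-1) col'"
    and visit_right: "\<And>w col'. w \<in> {1, 2} \<Longrightarrow> w \<le> r \<Longrightarrow> col w = 0 \<Longrightarrow> pending l col' \<Longrightarrow>
      \<forall>k\<ge>0. col' k = col k \<Longrightarrow> W l r w col'"
  shows "W l r 0 col"
proof -
  \<comment> \<open>A pending left side always has \<open>-1\<close> uncolored; hence the start can
    stop only if there is no left side.\<close>
  have far: "W l r 0 col'" if "pending l col'" "\<forall>k\<ge>0. col' k = col k" "l \<le> -2 \<Longrightarrow> col' (-2) \<noteq> 0" for col'
  proof (rule wins_start)
    fix w
    assume "w \<in> nb l r 0" "col' w = 0"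
    then have "w = -1 \<and> l \<le> -1 \<or> w \<in> {1, 2} \<and> w \<le> r \<and> col w = 0"
      using that by (auto simp: nb_iff)
    then show "W l r w col'" using visit_left visit_right that by auto
  next
    assume nz: "\<forall>w\<in>nb l r 0. col' w \<noteq> 0"
    have l: "l = 0"
    proof (rule ccontr)
      assume "l \<noteq> 0"
      with lr have "-1 \<in> nb l r 0" by (auto simp: nb_iff)
      with nz that(1) show False by (auto simp: pending_def)
    qed
    show "\<forall>k. l \<le> k \<and> k \<le> r \<longrightarrow> col' k \<noteq> 0"
    proof (intro allI impI notI)
      fix k assume k: "l \<le> k \<and> k \<le> r" and "col' k = 0"
      then have "0 < k" "col k = 0" using l that(2) col(1) by (cases "k = 0"; simp)+
      then obtain w where "w \<in> {1, 2}" "w \<le> r" "col w = 0" using right k by blast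
      then have "w \<in> nb l r 0" "col' w = 0" using lr that(2) by (auto simp: nb_iff)
      with nz show False by blast
    qed
  qed (use lr col that in auto)
  show ?thesis
  proof (cases "l \<le> -2 \<longrightarrow> col (-2) \<noteq> 0")
    case True
    then show ?thesis using far col(2) by blast
  next
    case False
    then have l: "l \<le> -2" and none: "\<forall>k<0. col k = 0" using col(2) by (auto simp: pending_def)
    have W2: "W l r (-2) col"
    proof (rule wins_touch)
      show "W l r 0 (col(-2 := 1))"
        using far[of "col(-2 := 1)"] pending_touch[OF none l] by simp
      show "col w = 0" if "w \<in> nb l r (-2)" "w \<noteq> 0" for w
        using that none by (auto simp: nb_iff)
    qed (use lr l col none in \<open>auto simp: nb_iff\<close>)
    show ?thesis
    proof (rule wins_start)
      fix w
      assume "w \<in> nb l r 0" "col w = 0"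
      then have "w = -1 \<and> l \<le> -1 \<or> w = -2 \<or> w \<in> {1, 2} \<and> w \<le> r"
        by (auto simp: nb_iff)
      then show "W l r w col" using visit_left visit_right col \<open>col w = 0\<close> W2 by auto
    next
      assume "\<forall>w\<in>nb l r 0. col w \<noteq> 0"
      moreover have "-2 \<in> nb l r 0" using l lr by (auto simp: nb_iff)
      ultimately show "\<forall>k. l \<le> k \<and> k \<le> r \<longrightarrow> col k \<noteq> 0" using none by auto
    qed (use lr col in auto)
  qed
qed

lemma last_1:
  assumes lr: "l \<le> 0" "1 \<le> r" and col: "col 0 = 4" "col 1 = 1" "pending l col"
    and right: "2 \<le> r \<Longrightarrow> col 2 \<notin> {3, 4}" "3 \<le> r \<Longrightarrow> col 3 \<notin> {3, 4}"
      "\<forall>k. 0 < k \<and> k \<le> r \<longrightarrow> col k \<noteq> 0"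
  shows "W l r 0 col"
proof (rule start_pending)
  fix col'
  assume l: "l \<le> -1" and col': "pending l col'" "\<forall>k\<ge>0. col' k = col k"
  show "W l r (-1) col'"
  proof (rule leave_left_1)
    fix col''
    assume col'': "\<forall>k\<ge>0. col'' k = col' k" "\<forall>k. l \<le> k \<and> k < 0 \<longrightarrow> col'' k \<noteq> 0"
    have "col'' k \<noteq> 0" if "l \<le> k \<and> k \<le> r" for k
    proof -
      consider "k < 0" | "k = 0" | "0 < k" by linarith
      then show ?thesis by cases (use col' col'' col right(3) that in auto)
    qed
    then show "W l r 0 col''" using lr col col' col'' by (intro wins_full) auto
  qed (use l lr col col' right in auto)
qed (use lr col right(3) in force)+

section \<open>A side whose second vertex was touched first\<close>

text \<open>These are the colors after \<open>2\<close> was touched, \<open>1\<close> was painted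
  between it and the start, and the rest was swept. The colors at \<open>3\<close> and
  \<open>4\<close> keep \<open>2\<close> an entrance.\<close>

definition right_done :: "int \<Rightarrow> (int \<Rightarrow> nat) \<Rightarrow> bool" where
  "right_done r col \<longleftrightarrow> 2 \<le> r \<and> col 0 = 4 \<and> col 1 = 2 \<and> col 2 = 1 \<and> (3 \<le> r \<longrightarrow> col 3 = 2) \<and>
     (4 \<le> r \<longrightarrow> col 4 = 2) \<and> (\<forall>k. 0 < k \<and> k \<le> r \<longrightarrow> col k \<noteq> 0)"

lemma right_done_cong: "right_done r col \<Longrightarrow> \<forall>k\<ge>0. col' k = col k \<Longrightarrow> right_done r col'"
  by (simp add: right_done_def)

lemma wins_home_2:
  assumes "l \<le> 0" "right_done r col" "W l r 0 col"
  shows "W l r 2 col"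
proof (rule wins_home)
  show "col w \<noteq> 3 \<and> col w \<noteq> 4" if "w \<in> nb l r 2" "w \<noteq> 0" for w
  proof -
    have "w = 1 \<or> w = 3 \<and> 3 \<le> r \<or> w = 4 \<and> 4 \<le> r" using that by (auto simp: nb_iff)
    then show ?thesis using assms(2) by (auto simp: right_done_def)
  qed
qed (use assms in \<open>auto simp: right_done_def nb_iff\<close>)

text \<open>Vertex \<open>1\<close> has color \<open>2\<close> and sees color \<open>1\<close> only
  at \<open>2\<close>, because \<open>-1\<close> has color \<open>3\<close>; and \<open>2\<close> is
  an entrance.\<close>

lemma finish_1_2:
  assumes lr: "l \<le> 0" and rd: "right_done r col"
    and left: "\<forall>k. l \<le> k \<and> k < 0 \<longrightarrow> col k \<noteq> 0" "l \<le> -1 \<Longrightarrow> col (-1) = 3"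
  shows "W l r 1 col" "W l r 2 col"
proof -
  note d = rd[unfolded right_done_def]
  have full: "col k \<noteq> 0" if "l \<le> k \<and> k \<le> r" for k
  proof -
    consider "k < 0" | "k = 0" | "0 < k" by linarith
    then show ?thesis by cases (use d left(1) that in auto)
  qed
  have W0: "W l r 0 col" using lr d full by (intro wins_full) auto
  show W2: "W l r 2 col" using wins_home_2[OF lr rd W0] .
  show "W l r 1 col"
  proof (rule walk_prv)
    have nb1: "w = -1 \<and> l \<le> -1 \<or> w = 0 \<or> w = 2 \<or> w = 3 \<and> 3 \<le> r" if "w \<in> nb l r 1" for w
      using that by (auto simp: nb_iff)
    show "\<not> sees l r col 1 0" using full by (auto simp: sees_def nb_iff)
    show "sees l r col 1 (prv (col 1))" using lr d by (simp add: sees_iff prv_def)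
    show "W l r w col" if "w \<in> nb l r 1" "col w = prv (col 1)" for w
      using nb1[OF that(1)] that(2) d left(2) W2 by (auto simp: prv_def)
  qed (use lr d in auto)
qed

lemma last_2:
  assumes lr: "l \<le> 0" and rd: "right_done r col" and pend: "pending l col"
  shows "W l r 0 col"
proof (rule start_pending)
  fix col'
  assume l: "l \<le> -1" and col': "pending l col'" "\<forall>k\<ge>0. col' k = col k"
  show "W l r (-1) col'"
  proof (rule leave_left_2)
    fix col''
    assume "\<forall>k\<ge>0. col'' k = col' k" "\<forall>k. l \<le> k \<and> k < 0 \<longrightarrow> col'' k \<noteq> 0" "col'' (-1) = 3"
    then show "W l r 1 col''"
      using lr col'(2) right_done_cong[OF rd, of col''] by (intro finish_1_2) auto
  qed (use l rd col' in \<open>auto simp: right_done_def\<close>)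
qed (use lr pend rd in \<open>force simp: right_done_def\<close>)+

text \<open>From \<open>2\<close> the agent goes home and the left side is explored from the start.
  From \<open>1\<close> the uncolored \<open>-1\<close> takes precedence over the way back, and the
  excursion to the left ends at \<open>1\<close> again.\<close>

lemma pending_1_2:
  assumes lr: "l \<le> 0" and rd: "right_done r col" and pend: "pending l col"
  shows "W l r 1 col" "W l r 2 col"
proof -
  note d = rd[unfolded right_done_def]
  show "W l r 2 col" using wins_home_2[OF lr rd last_2[OF assms]] .
  show "W l r 1 col"
  proof (cases "l = 0")
    case True
    then show ?thesis using rd by (intro finish_1_2) auto
  next
    case False
    show ?thesis
    proof (rule walk_zero)
      show "sees l r col 1 (prv (col 1)) \<or> \<not> sees l r col 1 4"
        using lr d by (simp add: sees_iff prv_def)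
      have z: "col (-1) = 0" using pend by (auto simp: pending_def)
      then show "sees l r col 1 0" using False lr d by (simp add: sees_iff)
      fix w assume w: "w \<in> nb l r 1" "col w = 0"
      have "w = -1 \<or> w = 0 \<or> w = 2 \<or> w = 3 \<and> 3 \<le> r" using w(1) by (auto simp: nb_iff)
      then have [simp]: "w = -1" using d w(2) by auto
      have "W l r (-1) col"
      proof (rule leave_left_2)
        fix col'
        assume "\<forall>k\<ge>0. col' k = col k" "\<forall>k. l \<le> k \<and> k < 0 \<longrightarrow> col' k \<noteq> 0" "col' (-1) = 3"
        then show "W l r 1 col'"
          using lr right_done_cong[OF rd, of col'] by (intro finish_1_2) auto
      qed (use False lr d pend in auto)
      then show "W l r w col" by simp
    qed (use lr d in auto)
  qed
qed

lemma leave_right_2: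
  assumes lr: "l \<le> 0" "3 \<le> r" and col: "col 0 = 4" "col 1 = 2" "col 2 = 1" "\<forall>k>2. col k = 0"
    and final: "\<And>col'. right_done r col' \<Longrightarrow> \<forall>k\<le>2. col' k = col k \<Longrightarrow> W l r 1 col' \<and> W l r 2 col'"
  shows "W l r 3 col"
proof -
  have "W l r (2 + 1) col"
  proof (rule sweep_right)
    fix q col'
    assume q: "q \<in> {2 - 1, 2 :: int}" and col': "\<forall>k\<le>2. col' k = col k" "\<forall>k. 2 < k \<and> k \<le> r \<longrightarrow> col' k \<noteq> 0"
      "col' (2 + 1) = nx (col (2 - 1)) (col 2)" "2 + 2 \<le> r \<Longrightarrow> col' (2 + 2) = nx (col 2) (nx (col (2 - 1)) (col 2))"
    have "col' k \<noteq> 0" if "0 < k \<and> k \<le> r" for k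
    proof -
      consider "k = 1" | "k = 2" | "2 < k" using \<open>0 < k \<and> k \<le> r\<close> by linarith
      then show ?thesis by cases (use col col' that in auto)
    qed
    then have "right_done r col'"
      using lr col col' by (simp add: right_done_def)
    from final[OF this col'(1)] q show "W l r q col'" by auto
  qed (use lr col in auto)
  then show ?thesis by simp
qed

lemma right_done_2:
  assumes "col 0 = 4" "col 1 = 2" "col 2 = 1"
  shows "right_done 2 col"
proof -
  have "col k \<noteq> 0" if "0 < k \<and> k \<le> 2" for k
  proof -
    have "k = 1 \<or> k = 2" using that by linarith
    then show ?thesis using assms by auto
  qed
  then show ?thesis using assms by (simp add: right_done_def)
qed

text \<open>If there is more to the right, \<open>3\<close> is the only uncolored neighbor of
  \<open>1\<close>; the sweep from there ends at \<open>1\<close> or \<open>2\<close>.\<close>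

lemma left_done_1:
  assumes lr: "l \<le> 0" "2 \<le> r" and col: "col 0 = 4" "col 1 = 2" "col 2 = 1" "\<forall>k>2. col k = 0"
    and left: "\<forall>k. l \<le> k \<and> k < 0 \<longrightarrow> col k \<noteq> 0" "l \<le> -1 \<Longrightarrow> col (-1) = 3"
  shows "W l r 1 col"
proof (cases "r = 2")
  case True
  then show ?thesis using lr col left right_done_2 by (intro finish_1_2) auto
next
  case False
  show ?thesis
  proof (rule walk_zero)
    show "sees l r col 1 (prv (col 1)) \<or> \<not> sees l r col 1 4"
      using lr col by (simp add: sees_iff prv_def)
    show "sees l r col 1 0" using False lr col by (simp add: sees_iff)
    fix w assume w: "w \<in> nb l r 1" "col w = 0"
    have "w = -1 \<and> l \<le> -1 \<or> w = 0 \<or> w = 2 \<or> w = 3" using w(1) by (auto simp: nb_iff)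
    then have [simp]: "w = 3" using col left w(2) by auto
    have "W l r 3 col"
    proof (rule leave_right_2)
      fix col'
      assume "right_done r col'" "\<forall>k\<le>2. col' k = col k"
      then show "W l r 1 col' \<and> W l r 2 col'"
        using lr left by (intro conjI finish_1_2) auto
    qed (use False lr col in auto)
    then show "W l r w col" by simp
  qed (use lr col in auto)
qed

text \<open>The critical case: the agent enters the gap between the start and \<open>2\<close>, from where the adversary
  may lead it to either side.\<close>

lemma fork:
  assumes lr: "l \<le> 0" "2 \<le> r" and col: "col 0 = 4" "col 1 = 0" "col 2 = 1" "\<forall>k>2. col k = 0"
    and pend: "pending l col"
  shows "W l r 1 col"
proof (rule wins_paint)
  show "2 = paint (sees l r col 1)"
  proof -
    have "sees l r col 1 x \<longleftrightarrow> x = 4 \<or> x = 1" if "x \<noteq> 0" for x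
      using lr col pend that by (auto simp: sees_iff pending_def)
    then show ?thesis by (simp add: paint_def)
  qed
  show "sees l r col 1 4 \<or> (\<forall>w\<in>nb l r 1. col w = 0) \<or>
      (\<exists>w\<in>nb l r 1. \<exists>w'\<in>nb l r 1. w \<noteq> w' \<and> col w \<in> {1, 2, 3} \<and> col w' \<in> {1, 2, 3})"
    using lr col by (simp add: sees_iff)
  let ?col = "col(1 := 2)"
  have pend': "pending l ?col" using pend by (rule pending_cong) simp
  have z: "col (-1) = 0" using pend by (auto simp: pending_def)
  show "W l r 1 ?col"
  proof (cases "l = 0 \<and> r = 2")
    case True
    then show ?thesis using col right_done_2[of ?col] by (intro finish_1_2) auto
  next
    case False
    show ?thesis
    proof (rule walk_zero)
      show "sees l r ?col 1 (prv (?col 1)) \<or> \<not> sees l r ?col 1 4"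
        using lr col by (simp add: sees_iff prv_def)
      show "sees l r ?col 1 0" using False lr col z by (auto simp: sees_iff)
      fix w assume w: "w \<in> nb l r 1" "?col w = 0"
      then have "w = -1 \<and> l \<le> -1 \<or> w = 3 \<and> 3 \<le> r" using col by (auto simp: nb_iff)
      then show "W l r w ?col"
      proof (elim disjE conjE)
        \<comment> \<open>The left side comes first: the forced return to \<open>1\<close> lets the
          agent enter the remaining right side before it can go home.\<close>
        assume [simp]: "w = -1" and l: "l \<le> -1"
        have "W l r (-1) ?col"
        proof (rule leave_left_2)
          fix col'
          assume "\<forall>k\<ge>0. col' k = ?col k" "\<forall>k. l \<le> k \<and> k < 0 \<longrightarrow> col' k \<noteq> 0" "col' (-1) = 3"
          then show "W l r 1 col'"
            using lr col by (intro left_done_1) auto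
        qed (use l lr col pend' in auto)
        then show ?thesis by simp
      next
        \<comment> \<open>The right side comes first: the sweep ends at \<open>1\<close> or
          \<open>2\<close> with the left side still pending.\<close>
        assume [simp]: "w = 3" and r: "3 \<le> r"
        have "W l r 3 ?col"
        proof (rule leave_right_2)
          fix col'
          assume "right_done r col'" "\<forall>k\<le>2. col' k = ?col k"
          then show "W l r 1 col' \<and> W l r 2 col'"
            using lr pending_cong[OF pend', of col'] by (intro conjI pending_1_2) auto
        qed (use r lr col in auto)
        then show ?thesis by simp
      qed
    qed (use lr col in auto)
  qed
qed (use lr col in auto)

text \<open>A step to \<open>-1\<close> completes the left side, and a step to \<open>2\<close>
  completes the right side through the entrance \<open>1\<close>. Either way the agent is back at
  the start with an uncolored neighbor on the other side if anything is missing there.\<close>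

lemma near_start:
  assumes lr: "l \<le> 0" "1 \<le> r" and col: "col 0 = 4" "col 1 = 1" "\<forall>k>1. col k = 0"
    and pend: "pending l col"
  shows "W l r 0 col"
proof (rule start_pending)
  show "\<exists>w\<in>{1, 2}. w \<le> r \<and> col w = 0" if "0 < k" "k \<le> r" "col k = 0" for k
  proof -
    have "k \<noteq> 1" using col that by auto
    then show ?thesis using col that by auto
  qed
next
  fix col'
  assume l: "l \<le> -1" and col': "pending l col'" "\<forall>k\<ge>0. col' k = col k"
  show "W l r (-1) col'"
  proof (rule leave_left_1)
    fix col''
    assume "\<forall>k\<ge>0. col'' k = col' k" "\<forall>k. l \<le> k \<and> k < 0 \<longrightarrow> col'' k \<noteq> 0" "col'' (-1) = 2"
    then show "W l r 0 col''"
      using lr col col' by (intro last_near_mirrored) auto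
  qed (use l lr col col' in auto)
next
  fix w :: int and col'
  assume "w \<in> {1, 2}" and r: "w \<le> r" and "col w = 0" and col': "pending l col'" "\<forall>k\<ge>0. col' k = col k"
  then have [simp]: "w = 2" using col by auto
  have "W l r (1 + 1) col'"
  proof (rule sweep_right)
    fix q col''
    assume q: "q \<in> {1 - 1, 1}" "col' q \<noteq> 4" and col'': "\<forall>k\<le>1. col'' k = col' k"
      "\<forall>k. 1 < k \<and> k \<le> r \<longrightarrow> col'' k \<noteq> 0" "col'' (1 + 1) = nx (col' (1 - 1)) (col' 1)"
      "1 + 2 \<le> r \<Longrightarrow> col'' (1 + 2) = nx (col' 1) (nx (col' (1 - 1)) (col' 1))"
    have [simp]: "q = 1" using q col col' by auto
    have pend'': "pending l col''" using col'(1) by (rule pending_cong) (use col'' in simp)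
    have nz: "col'' k \<noteq> 0" if "0 < k \<and> k \<le> r" for k
    proof -
      consider "k = 1" | "1 < k" using \<open>0 < k \<and> k \<le> r\<close> by linarith
      then show ?thesis by cases (use col col' col'' that in auto)
    qed
    have "W l r 1 col''"
    proof (rule wins_home)
      show "col'' w \<noteq> 3 \<and> col'' w \<noteq> 4" if "w \<in> nb l r 1" "w \<noteq> 0" for w
      proof -
        have "w = -1 \<or> w = 2 \<or> w = 3 \<and> 3 \<le> r" using that by (auto simp: nb_iff)
        then show ?thesis using pend'' col col' col'' by (auto simp: pending_def)
      qed
      show "W l r 0 col''"
        using lr r col col' col'' pend'' nz by (intro last_1) auto
    qed (use lr col col' col'' in \<open>auto simp: nb_iff\<close>)
    then show "W l r q col''" by simp
  qed (use lr r col col' in auto)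
  then show "W l r w col'" by simp
qed (use lr col pend in auto)

text \<open>On the right only \<open>1\<close> is open, which is the fork. On the left,
  \<open>-1\<close> is either merely touched, giving the mirrored \<open>near_start\<close> with
  \<open>2\<close> as the touched vertex of the pending side, or it lies between the start and a
  touched \<open>-2\<close>, giving the mirrored fork.\<close>

lemma far_start:
  assumes lr: "l \<le> 0" "2 \<le> r" and col: "col 0 = 4" "col 2 = 1" "\<forall>k>0. k \<noteq> 2 \<longrightarrow> col k = 0"
    and pend: "pending l col"
  shows "W l r 0 col"
proof (rule start_pending)
  show "\<exists>w\<in>{1, 2}. w \<le> r \<and> col w = 0" using lr col by auto
next
  fix col'
  assume l: "l \<le> -1" and col': "pending l col'" "\<forall>k\<ge>0. col' k = col k"
  show "W l r (-1) col'"
  proof (cases "\<forall>k<0. col' k = 0")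
    case True
    show ?thesis
    proof (rule wins_touch)
      show "col' w = 0" if "w \<in> nb l r (-1)" "w \<noteq> 0" for w
        using that True col col' by (auto simp: nb_iff)
      have "W (- r) (- l) 0 (\<lambda>k. (col'(-1 := 1)) (- k))"
        by (rule near_start) (use l lr col col' True in \<open>auto simp: pending_def\<close>)
      then show "W l r 0 (col'(-1 := 1))"
        by - (rule wins_reflect, simp)
    qed (use l lr col col' True in \<open>auto simp: nb_iff\<close>)
  next
    case False
    have "W (- r) (- l) 1 (\<lambda>k. col' (- k))"
      by (rule fork) (use False l lr col col' in \<open>auto simp: pending_def\<close>)
    then show ?thesis
      by - (rule wins_reflect, simp)
  qed
next
  fix w :: int and col'
  assume "w \<in> {1, 2}" "w \<le> r" "col w = 0" and col': "pending l col'" "\<forall>k\<ge>0. col' k = col k"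
  then have [simp]: "w = 1" using col by auto
  show "W l r w col'"
    unfolding \<open>w = 1\<close> by (rule fork) (use lr col col' in auto)
qed (use lr col pend in auto)

section \<open>The first steps and the conclusion\<close>

lemma first_right:
  assumes "l \<le> 0" "w \<in> {1, 2}" "w \<le> r"
  shows "W l r w ((\<lambda>_. 0)(0 := 4))"
proof (rule wins_touch)
  show "W l r 0 (((\<lambda>_. 0)(0 := 4))(w := 1))"
  proof (cases "w = 1")
    case True
    show ?thesis unfolding True by (rule near_start) (use assms True in \<open>auto simp: pending_def\<close>)
  next
    case False
    with assms have 2: "w = 2" by auto
    show ?thesis unfolding 2 by (rule far_start) (use assms 2 in \<open>auto simp: pending_def\<close>)
  qed
qed (use assms in \<open>auto simp: nb_iff\<close>)

lemma wins_segment: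
  assumes lr: "l \<le> 0" "0 \<le> r"
  shows "W l r 0 (\<lambda>_. 0)"
proof (rule wins_paint)
  show "W l r 0 ((\<lambda>_. 0)(0 := 4))"
  proof (rule wins_start)
    fix w assume w: "w \<in> nb l r 0"
    show "W l r w ((\<lambda>_. 0)(0 := 4))"
    proof (cases "w > 0")
      case True
      then show ?thesis using w lr by (intro first_right) (auto simp: nb_iff)
    next
      case False
      have "W (- r) (- l) (- w) ((\<lambda>_. 0)(0 := 4))"
        using False w lr by (intro first_right) (auto simp: nb_iff)
      moreover have "((\<lambda>_. 0)(0 := 4)) = (\<lambda>k. ((\<lambda>_. 0 :: nat)(0 := 4)) (- k :: int))"
        by (auto simp: fun_eq_iff)
      ultimately show ?thesis by (metis wins_reflect)
    qed
  next
    assume nz: "\<forall>w\<in>nb l r 0. ((\<lambda>_. 0 :: nat)(0 := 4)) w \<noteq> 0"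
    have "w \<notin> nb l r 0" for w
    proof
      assume w: "w \<in> nb l r 0"
      then have "w \<noteq> 0" by (auto simp: nb_iff)
      with w nz show False by auto
    qed
    from this[of "-1"] this[of 1] have "l = 0" "r = 0" using lr by (auto simp: nb_iff)
    then show "\<forall>k. l \<le> k \<and> k \<le> r \<longrightarrow> ((\<lambda>_. 0 :: nat)(0 := 4)) k \<noteq> 0" by auto
  qed (use lr in auto)
  show "4 = paint (sees l r (\<lambda>_. 0) 0)" by (simp add: paint_def sees_iff)
qed (use lr in auto)

theorem theorem10:
  shows "\<exists>move. is_algorithm move \<and> assigns_only move {1, 2, 3, 4} \<and>
           (\<forall>n\<ge>1. successfully_explores move (square_path n))"
proof (intro exI conjI allI impI)
  show "is_algorithm explorer" by (rule is_algorithm_explorer)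
  show "assigns_only explorer {1, 2, 3, 4}" by (rule assigns_only_explorer)
  fix n :: nat
  show "successfully_explores explorer (square_path n)"
    by (intro successfully_exploresI wins_square_path wins_segment) (auto simp: square_path_def)
qed

end
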